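(* Let $\alpha>0$, let the data $(\boldsymbol y,\boldsymbol X)$ be split into $K$ mini-batches $(\boldsymbol y_k,\boldsymbol X_k)$, $k=1,\dots,K$, and let $\mathcal L_{PEP}$ be the batch PEP lower bound and $\psi^{(K)}=\sum_{k=1}^K\psi_k$ the recursive collapsed bound of the PEP model, both as functions of the parameters $\boldsymbol\theta\in\boldsymbol\Theta$ (as defined in the context). Fix a parameter vector $\bar{\boldsymbol\theta}\in\boldsymbol\Theta$, kept the same for all mini-batches. Then, for every scalar component $\theta$ of $\boldsymbol\theta$, the partial derivative of the batch bound at $\bar{\boldsymbol\theta}$ equals the cumulative derivative obtained by the recursive gradient propagation procedure at $\bar{\boldsymbol\theta}$: $$\frac{\partial \mathcal L_{PEP}(\bar{\boldsymbol\theta})}{\partial\theta}=\sum_{k=1}^K\dot\psi_k(\bar{\boldsymbol\theta}).$$ That is, $\frac{\partial \mathcal L_{PEP}(\bar{\boldsymbol\theta})}{\partial\boldsymbol\theta}=\frac{\partial\psi^{(K)}(\bar{\boldsymbol\theta})}{\partial\boldsymbol\theta}$, where the right-hand side is the sum over $k$ of the recursively propagated derivatives $\dot\psi_k$ defined in the context.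
   Context: **Data and kernel.** $\boldsymbol X\in\mathbb R^{N\times D}$ has rows $\boldsymbol x_1,\dots,\boldsymbol x_N$ and $\boldsymbol y\in\mathbb R^N$. The data are split consecutively into $K$ mini-batches $\boldsymbol X_k\in\mathbb R^{B\times D}$, $\boldsymbol y_k\in\mathbb R^B$ with $N=KB$. $k(\cdot,\cdot)$ is a positive definite kernel on $\mathbb R^D$ depending on kernel hyper-parameters; for matrices $\boldsymbol A,\boldsymbol B$ with rows $\boldsymbol a_i,\boldsymbol b_j\in\mathbb R^D$, $[\boldsymbol K_{\boldsymbol A\boldsymbol B}]_{ij}=k(\boldsymbol a_i,\boldsymbol b_j)$. $\boldsymbol R\in\mathbb R^{M\times D}$ is the matrix of inducing inputs and $\sigma_n>0$ the noise standard deviation. The parameter vector $\boldsymbol\theta$ consists of the kernel hyper-parameters, $\sigma_n$, and all entries of $\boldsymbol R$; it ranges over an open set $\boldsymbol\Theta$ on which $\boldsymbol K_{\boldsymbol R\boldsymbol R}$ is invertible. The kernel is assumed differentiable jointly in its hyper-parameters and its two inputs. All quantities below depend on $\boldsymbol\theta$. $\mathcal N(\boldsymbol y\mid\boldsymbol m,\boldsymbol C)$ denotes the multivariate Gaussian density with mean $\boldsymbol m$ and covariance $\boldsymbol C$, $\mathbb I$ the identity matrix, and $\mathrm{Diag}[\boldsymbol A]$ the diagonal matrix with the same diagonal as the square matrix $\boldsymbol A$. Put $\boldsymbol Q_{\boldsymbol A\boldsymbol B}=\boldsymbol K_{\boldsymbol A\boldsymbol R}\boldsymbol K_{\boldsymbol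 R\boldsymbol R}^{-1}\boldsymbol K_{\boldsymbol R\boldsymbol B}$ and $\boldsymbol D_{\boldsymbol A}=\boldsymbol K_{\boldsymbol A\boldsymbol A}-\boldsymbol Q_{\boldsymbol A\boldsymbol A}$. **Batch PEP bound.** $$\mathcal L_{PEP}(\boldsymbol\theta)=\log\mathcal N\big(\boldsymbol y\mid\boldsymbol 0,\ \boldsymbol Q_{\boldsymbol X\boldsymbol X}+\alpha\,\mathrm{Diag}[\boldsymbol D_{\boldsymbol X}]+\sigma_n^2\mathbb I\big)-\frac{1-\alpha}{2\alpha}\sum_{i=1}^N\log\Big(1+\frac{\alpha}{\sigma_n^2}[\boldsymbol D_{\boldsymbol X}]_{ii}\Big).$$ **Recursive collapsed bound (PEP model).** Let $\boldsymbol\mu_0=\boldsymbol 0\in\mathbb R^M$, $\boldsymbol\Sigma_0=\boldsymbol K_{\boldsymbol R\boldsymbol R}$ and, for $k=1,\dots,K$, $$\boldsymbol H_k=\boldsymbol K_{\boldsymbol X_k\boldsymbol R}\boldsymbol K_{\boldsymbol R\boldsymbol R}^{-1},\quad \boldsymbol V_k=\alpha\,\mathrm{Diag}[\boldsymbol D_{\boldsymbol X_k}]+\sigma_n^2\mathbb I,$$ $$\boldsymbol r_k=\boldsymbol y_k-\boldsymbol H_k\boldsymbol\mu_{k-1},\quad \boldsymbol S_k=\boldsymbol H_k\boldsymbol\Sigma_{k-1}\boldsymbol H_k^T+\boldsymbol V_k,\quad \boldsymbol G_k=\boldsymbol\Sigma_{k-1}\boldsymbol H_k^T\boldsymbol S_k^{-1},$$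 $$\boldsymbol\mu_k=\boldsymbol\mu_{k-1}+\boldsymbol G_k\boldsymbol r_k,\quad \boldsymbol\Sigma_k=\boldsymbol\Sigma_{k-1}-\boldsymbol G_k\boldsymbol S_k\boldsymbol G_k^T.$$ Define $d_k(\boldsymbol\theta)=\log\mathcal N(\boldsymbol r_k\mid\boldsymbol 0,\boldsymbol S_k)$, $a_k(\boldsymbol\theta)=\frac{1-\alpha}{2\alpha}\sum_{i=1}^B\log\big(1+\frac{\alpha}{\sigma_n^2}[\boldsymbol D_{\boldsymbol X_k}]_{ii}\big)$, $\psi_k=d_k-a_k$, and $\psi^{(K)}=\sum_{k=1}^K\psi_k$. **Recursive gradient propagation.** Fix a scalar component $\theta$ of $\boldsymbol\theta$. For the quantities given explicitly in terms of the kernel and $\sigma_n$ (namely $\boldsymbol K_{\boldsymbol R\boldsymbol R},\boldsymbol H_k,\boldsymbol V_k,a_k$), a dot denotes the partial derivative with respect to $\theta$. For the recursively computed quantities, the dotted quantities are defined by $\dot{\boldsymbol\mu}_0=\boldsymbol 0$, $\dot{\boldsymbol\Sigma}_0=\dot{\boldsymbol K}_{\boldsymbol R\boldsymbol R}$ and, for $k=1,\dots,K$, $$\dot{\boldsymbol r}_k=-\dot{\boldsymbol H}_k\boldsymbol\mu_{k-1}-\boldsymbol H_k\dot{\boldsymbol\mu}_{k-1},$$ $$\dot{\boldsymbol S}_k=\dot{\boldsymbol H}_k\boldsymbol\Sigma_{k-1}\boldsymbol H_k^T+\boldsymbol H_k\dot{\boldsymbol\Sigma}_{k-1}\boldsymbol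 H_k^T+\boldsymbol H_k\boldsymbol\Sigma_{k-1}\dot{\boldsymbol H}_k^T+\dot{\boldsymbol V}_k,$$ $$\dot{\boldsymbol G}_k=\dot{\boldsymbol\Sigma}_{k-1}\boldsymbol H_k^T\boldsymbol S_k^{-1}+\boldsymbol\Sigma_{k-1}\dot{\boldsymbol H}_k^T\boldsymbol S_k^{-1}-\boldsymbol\Sigma_{k-1}\boldsymbol H_k^T\boldsymbol S_k^{-1}\dot{\boldsymbol S}_k\boldsymbol S_k^{-1},$$ $$\dot{\boldsymbol\mu}_k=\dot{\boldsymbol\mu}_{k-1}+\dot{\boldsymbol G}_k\boldsymbol r_k+\boldsymbol G_k\dot{\boldsymbol r}_k,$$ $$\dot{\boldsymbol\Sigma}_k=\dot{\boldsymbol\Sigma}_{k-1}-\dot{\boldsymbol G}_k\boldsymbol S_k\boldsymbol G_k^T-\boldsymbol G_k\dot{\boldsymbol S}_k\boldsymbol G_k^T-\boldsymbol G_k\boldsymbol S_k\dot{\boldsymbol G}_k^T,$$ $$\dot d_k=-\tfrac12\mathrm{Tr}\big[\boldsymbol S_k^{-1}\dot{\boldsymbol S}_k\big]-\boldsymbol r_k^T\boldsymbol S_k^{-1}\dot{\boldsymbol r}_k+\tfrac12\boldsymbol r_k^T\boldsymbol S_k^{-1}\dot{\boldsymbol S}_k\boldsymbol S_k^{-1}\boldsymbol r_k,\qquad \dot\psi_k=\dot d_k-\dot a_k,$$ everything being evaluated at the same parameter vector $\bar{\boldsymbol\theta}$ for all $k$. *)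

theory Defs
  imports "HOL-Analysis.Analysis"
begin

text \<open>
  A parameter vector consists of the kernel hyper-parameters, the noise standard deviation
  and the matrix of inducing inputs (one inducing input per row).  Its scalar components
  correspond to the elements of \<^const>\<open>Basis\<close>.
\<close>

type_synonym ('p, 'd, 'm) params = "(real^'p) \<times> real \<times> (real^'d^'m)"

type_synonym ('p, 'd) kernel = "real^'p \<Rightarrow> real^'d \<Rightarrow> real^'d \<Rightarrow> real"

abbreviation hyper :: "('p::finite, 'd::finite, 'm::finite) params \<Rightarrow> real^'p" where
  "hyper \<theta> \<equiv> fst \<theta>"

abbreviation noise :: "('p::finite, 'd::finite, 'm::finite) params \<Rightarrow> real" where
  "noise \<theta> \<equiv> fst (snd \<theta>)"

abbreviation inducing :: "('p::finite, 'd::finite, 'm::finite) params \<Rightarrow> real^'d^'m" where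
  "inducing \<theta> \<equiv> snd (snd \<theta>)"

definition partial_deriv :: "'a::real_normed_vector \<Rightarrow> ('a \<Rightarrow> 'b::real_normed_vector) \<Rightarrow> 'a \<Rightarrow> 'b" where
  "partial_deriv e f \<theta> = vector_derivative (\<lambda>t. f (\<theta> + t *\<^sub>R e)) (at 0)"

text \<open>
  Positive definiteness in the usual sense for kernels: every Gram matrix is symmetric and
  positive semidefinite.
\<close>

definition pos_def_kernel :: "('a \<Rightarrow> 'a \<Rightarrow> real) \<Rightarrow> bool" where
  "pos_def_kernel k \<longleftrightarrow>
     (\<forall>x x'. k x x' = k x' x) \<and>
     (\<forall>n (x :: nat \<Rightarrow> 'a) (c :: nat \<Rightarrow> real). 0 \<le> (\<Sum>i<n. \<Sum>j<n. c i * c j * k (x i) (x j)))"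

definition diag_part :: "real^'n^'n \<Rightarrow> real^'n^'n" where
  "diag_part A = (\<chi> i j. if i = j then A $ i $ j else 0)"

definition gauss_density :: "real^'n \<Rightarrow> real^'n \<Rightarrow> real^'n^'n \<Rightarrow> real" where
  "gauss_density y m C =
     exp (- (1/2) * ((y - m) \<bullet> (matrix_inv C *v (y - m)))) / sqrt ((2 * pi) ^ CARD('n) * det C)"

text \<open>
  The \<open>k\<close>-th block (counting from \<open>k = 1\<close>) of \<open>CARD('b)\<close> consecutive rows.  The index types are
  linearly ordered, so that \<open>card {..<b}\<close> is the zero-based position of \<open>b\<close> in its type.
\<close>

definition mini_batch :: "'a^'n::{finite,linorder} \<Rightarrow> nat \<Rightarrow> 'a^'b::{finite,linorder}" where
  "mini_batch A k =
     (\<chi> b. A $ (sorted_list_of_set (UNIV :: 'n set) ! ((k - 1) * CARD('b) + card {..<b})))"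

locale sparse_gp =
  fixes \<kappa> :: "('p::finite, 'd::finite) kernel"
    and \<alpha> :: real
begin

definition Kmat :: "('p, 'd, 'm::finite) params \<Rightarrow> real^'d^'i \<Rightarrow> real^'d^'j \<Rightarrow> real^'j^'i" where
  "Kmat \<theta> A B = (\<chi> i j. \<kappa> (hyper \<theta>) (A $ i) (B $ j))"

definition KRR :: "('p, 'd, 'm::finite) params \<Rightarrow> real^'m^'m" where
  "KRR \<theta> = Kmat \<theta> (inducing \<theta>) (inducing \<theta>)"

definition Qmat :: "('p, 'd, 'm::finite) params \<Rightarrow> real^'d^'i \<Rightarrow> real^'d^'j \<Rightarrow> real^'j^'i" where
  "Qmat \<theta> A B = Kmat \<theta> A (inducing \<theta>) ** matrix_inv (KRR \<theta>) ** Kmat \<theta> (inducing \<theta>) B"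

definition Dmat :: "('p, 'd, 'm::finite) params \<Rightarrow> real^'d^'i \<Rightarrow> real^'i^'i" where
  "Dmat \<theta> A = Kmat \<theta> A A - Qmat \<theta> A A"

definition L_PEP :: "real^'d^'n \<Rightarrow> real^'n \<Rightarrow> ('p, 'd, 'm::finite) params \<Rightarrow> real" where
  "L_PEP X y \<theta> =
     ln (gauss_density y 0
           (Qmat \<theta> X X + \<alpha> *\<^sub>R diag_part (Dmat \<theta> X) + (noise \<theta>)\<^sup>2 *\<^sub>R mat 1))
     - (1 - \<alpha>) / (2 * \<alpha>) * (\<Sum>i\<in>UNIV. ln (1 + \<alpha> / (noise \<theta>)\<^sup>2 * Dmat \<theta> X $ i $ i))"

end

locale pep_recursion = sparse_gp \<kappa> \<alpha>
  for \<kappa> :: "('p::finite, 'd::finite) kernel" and \<alpha> :: real +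
  fixes Xs :: "nat \<Rightarrow> real^'d^'b::finite"
    and ys :: "nat \<Rightarrow> real^'b"
begin

definition H :: "('p, 'd, 'm::finite) params \<Rightarrow> nat \<Rightarrow> real^'m^'b" where
  "H \<theta> k = Kmat \<theta> (Xs k) (inducing \<theta>) ** matrix_inv (KRR \<theta>)"

definition V :: "('p, 'd, 'm::finite) params \<Rightarrow> nat \<Rightarrow> real^'b^'b" where
  "V \<theta> k = \<alpha> *\<^sub>R diag_part (Dmat \<theta> (Xs k)) + (noise \<theta>)\<^sup>2 *\<^sub>R mat 1"

definition a :: "('p, 'd, 'm::finite) params \<Rightarrow> nat \<Rightarrow> real" where
  "a \<theta> k =
     (1 - \<alpha>) / (2 * \<alpha>) * (\<Sum>i\<in>UNIV. ln (1 + \<alpha> / (noise \<theta>)\<^sup>2 * Dmat \<theta> (Xs k) $ i $ i))"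

text \<open>
  The values of \<open>r\<close>, \<open>S\<close>, \<open>G\<close> at index \<open>0\<close> (where \<open>k - 1 = 0\<close>) have no meaning and are never
  used below for the indices \<open>k \<ge> 1\<close>; the same holds for the propagated derivatives.
\<close>

function \<mu> :: "('p, 'd, 'm::finite) params \<Rightarrow> nat \<Rightarrow> real^'m"
  and \<Sigma> :: "('p, 'd, 'm) params \<Rightarrow> nat \<Rightarrow> real^'m^'m"
  and r :: "('p, 'd, 'm) params \<Rightarrow> nat \<Rightarrow> real^'b"
  and S :: "('p, 'd, 'm) params \<Rightarrow> nat \<Rightarrow> real^'b^'b"
  and G :: "('p, 'd, 'm) params \<Rightarrow> nat \<Rightarrow> real^'b^'m"
where
  "\<mu> \<theta> 0 = 0"
| "\<mu> \<theta> (Suc k) = \<mu> \<theta> k + G \<theta> (Suc k) *v r \<theta> (Suc k)"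
| "\<Sigma> \<theta> 0 = KRR \<theta>"
| "\<Sigma> \<theta> (Suc k) = \<Sigma> \<theta> k - G \<theta> (Suc k) ** S \<theta> (Suc k) ** transpose (G \<theta> (Suc k))"
| "r \<theta> k = ys k - H \<theta> k *v \<mu> \<theta> (k - 1)"
| "S \<theta> k = H \<theta> k ** \<Sigma> \<theta> (k - 1) ** transpose (H \<theta> k) + V \<theta> k"
| "G \<theta> k = \<Sigma> \<theta> (k - 1) ** transpose (H \<theta> k) ** matrix_inv (S \<theta> k)"
  by pat_completeness auto
termination
  by (relation "Wellfounded.measure (case_sum
        (case_sum (\<lambda>(\<theta>, k). if k = 0 then 0 else 4 * k + 3)
                  (\<lambda>(\<theta>, k). if k = 0 then 0 else 4 * k + 3))
        (case_sum (\<lambda>(\<theta>, k). 4 * k + 1)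
                  (case_sum (\<lambda>(\<theta>, k). 4 * k + 1) (\<lambda>(\<theta>, k). 4 * k + 2))))")
     (auto split: if_splits)

definition d :: "('p, 'd, 'm::finite) params \<Rightarrow> nat \<Rightarrow> real" where
  "d \<theta> k = ln (gauss_density (r \<theta> k) 0 (S \<theta> k))"

definition \<psi> :: "('p, 'd, 'm::finite) params \<Rightarrow> nat \<Rightarrow> real" where
  "\<psi> \<theta> k = d \<theta> k - a \<theta> k"

definition \<psi>_total :: "nat \<Rightarrow> ('p, 'd, 'm::finite) params \<Rightarrow> real" where
  "\<psi>_total K \<theta> = (\<Sum>k=1..K. \<psi> \<theta> k)"

text \<open>
  Recursive gradient propagation for the scalar component \<open>e \<in> Basis\<close>.
\<close>

definition KRR_dot :: "('p, 'd, 'm::finite) params \<Rightarrow> ('p, 'd, 'm) params \<Rightarrow> real^'m^'m" where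
  "KRR_dot e \<theta> = partial_deriv e KRR \<theta>"

definition H_dot :: "('p, 'd, 'm::finite) params \<Rightarrow> ('p, 'd, 'm) params \<Rightarrow> nat \<Rightarrow> real^'m^'b" where
  "H_dot e \<theta> k = partial_deriv e (\<lambda>\<theta>. H \<theta> k) \<theta>"

definition V_dot :: "('p, 'd, 'm::finite) params \<Rightarrow> ('p, 'd, 'm) params \<Rightarrow> nat \<Rightarrow> real^'b^'b" where
  "V_dot e \<theta> k = partial_deriv e (\<lambda>\<theta>. V \<theta> k) \<theta>"

definition a_dot :: "('p, 'd, 'm::finite) params \<Rightarrow> ('p, 'd, 'm) params \<Rightarrow> nat \<Rightarrow> real" where
  "a_dot e \<theta> k = partial_deriv e (\<lambda>\<theta>. a \<theta> k) \<theta>"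

function \<mu>_dot :: "('p, 'd, 'm::finite) params \<Rightarrow> ('p, 'd, 'm) params \<Rightarrow> nat \<Rightarrow> real^'m"
  and \<Sigma>_dot :: "('p, 'd, 'm) params \<Rightarrow> ('p, 'd, 'm) params \<Rightarrow> nat \<Rightarrow> real^'m^'m"
  and r_dot :: "('p, 'd, 'm) params \<Rightarrow> ('p, 'd, 'm) params \<Rightarrow> nat \<Rightarrow> real^'b"
  and S_dot :: "('p, 'd, 'm) params \<Rightarrow> ('p, 'd, 'm) params \<Rightarrow> nat \<Rightarrow> real^'b^'b"
  and G_dot :: "('p, 'd, 'm) params \<Rightarrow> ('p, 'd, 'm) params \<Rightarrow> nat \<Rightarrow> real^'b^'m"
where
  "\<mu>_dot e \<theta> 0 = 0"
| "\<mu>_dot e \<theta> (Suc k) =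
     \<mu>_dot e \<theta> k + G_dot e \<theta> (Suc k) *v r \<theta> (Suc k) + G \<theta> (Suc k) *v r_dot e \<theta> (Suc k)"
| "\<Sigma>_dot e \<theta> 0 = KRR_dot e \<theta>"
| "\<Sigma>_dot e \<theta> (Suc k) =
     \<Sigma>_dot e \<theta> k
     - G_dot e \<theta> (Suc k) ** S \<theta> (Suc k) ** transpose (G \<theta> (Suc k))
     - G \<theta> (Suc k) ** S_dot e \<theta> (Suc k) ** transpose (G \<theta> (Suc k))
     - G \<theta> (Suc k) ** S \<theta> (Suc k) ** transpose (G_dot e \<theta> (Suc k))"
| "r_dot e \<theta> k = - (H_dot e \<theta> k *v \<mu> \<theta> (k - 1)) - H \<theta> k *v \<mu>_dot e \<theta> (k - 1)"
| "S_dot e \<theta> k =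
     H_dot e \<theta> k ** \<Sigma> \<theta> (k - 1) ** transpose (H \<theta> k)
     + H \<theta> k ** \<Sigma>_dot e \<theta> (k - 1) ** transpose (H \<theta> k)
     + H \<theta> k ** \<Sigma> \<theta> (k - 1) ** transpose (H_dot e \<theta> k)
     + V_dot e \<theta> k"
| "G_dot e \<theta> k =
     \<Sigma>_dot e \<theta> (k - 1) ** transpose (H \<theta> k) ** matrix_inv (S \<theta> k)
     + \<Sigma> \<theta> (k - 1) ** transpose (H_dot e \<theta> k) ** matrix_inv (S \<theta> k)
     - \<Sigma> \<theta> (k - 1) ** transpose (H \<theta> k)
         ** matrix_inv (S \<theta> k) ** S_dot e \<theta> k ** matrix_inv (S \<theta> k)"
  by pat_completeness auto
termination
  by (relation "Wellfounded.measure (case_sum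
        (case_sum (\<lambda>(e, \<theta>, k). if k = 0 then 0 else 4 * k + 3)
                  (\<lambda>(e, \<theta>, k). if k = 0 then 0 else 4 * k + 3))
        (case_sum (\<lambda>(e, \<theta>, k). 4 * k + 1)
                  (case_sum (\<lambda>(e, \<theta>, k). 4 * k + 1) (\<lambda>(e, \<theta>, k). 4 * k + 2))))")
     (auto split: if_splits)

definition d_dot :: "('p, 'd, 'm::finite) params \<Rightarrow> ('p, 'd, 'm) params \<Rightarrow> nat \<Rightarrow> real" where
  "d_dot e \<theta> k =
     - (1/2) * trace (matrix_inv (S \<theta> k) ** S_dot e \<theta> k)
     - r \<theta> k \<bullet> (matrix_inv (S \<theta> k) *v r_dot e \<theta> k)
     + 1/2 * (r \<theta> k \<bullet> ((matrix_inv (S \<theta> k) ** S_dot e \<theta> k ** matrix_inv (S \<theta> k)) *v r \<theta> k))"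

definition \<psi>_dot :: "('p, 'd, 'm::finite) params \<Rightarrow> ('p, 'd, 'm) params \<Rightarrow> nat \<Rightarrow> real" where
  "\<psi>_dot e \<theta> k = d_dot e \<theta> k - a_dot e \<theta> k"

end

end

theory Submission imports Defs
begin

text \<open>
  On \<open>\<Theta>\<close> the two bounds are equal as functions of the parameters.  In information form the
  filter accumulates \<open>\<Sigma>\<^sub>k\<^sup>-\<^sup>1 = K\<^sub>R\<^sub>R\<^sup>-\<^sup>1 + \<Sum>\<^sub>j H\<^sub>j\<^sup>T V\<^sub>j\<^sup>-\<^sup>1 H\<^sub>j\<close> and
  \<open>\<Sigma>\<^sub>k\<^sup>-\<^sup>1 \<mu>\<^sub>k = \<Sum>\<^sub>j H\<^sub>j\<^sup>T V\<^sub>j\<^sup>-\<^sup>1 y\<^sub>j\<close>.  By Woodbury and Sylvester the log-determinants and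
  quadratic forms of the innovations telescope, so the recursive bound depends on the data only
  through sums over single observations (\<open>V\<^sub>j\<close> is diagonal) and not on their grouping.  The batch
  bound is the case of one batch.  It remains to differentiate the recursion step by step; the
  propagated quantities are the true derivatives by the product rule, Jacobi's formula and
  the derivative of the matrix inverse.
\<close>

section \<open>Matrix calculus\<close>

lemma bounded_bilinear_matrix_matrix_mult:
  "bounded_bilinear ((**) :: real^'n^'m \<Rightarrow> real^'p^'n \<Rightarrow> real^'p^'m)"
  unfolding bilinear_conv_bounded_bilinear[symmetric] bilinear_def
  by (auto intro!: linearI simp: matrix_matrix_mult_def vec_eq_iff sum.distrib distrib_left distrib_right sum_distrib_left mult_ac)

lemma bounded_bilinear_matrix_vector_mult:
  "bounded_bilinear ((*v) :: real^'n^'m \<Rightarrow> real^'n \<Rightarrow> real^'m)"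
  unfolding bilinear_conv_bounded_bilinear[symmetric] bilinear_def
  by (auto intro!: linearI simp: matrix_vector_mult_def vec_eq_iff sum.distrib distrib_left distrib_right sum_distrib_left mult_ac)

lemma bounded_linear_transpose: "bounded_linear (transpose :: real^'n^'m \<Rightarrow> real^'m^'n)"
  unfolding linear_conv_bounded_linear[symmetric]
  by (auto intro!: linearI simp: transpose_def vec_eq_iff)

lemmas has_vector_derivative_matrix_matrix_mult =
  bounded_bilinear.has_vector_derivative[OF bounded_bilinear_matrix_matrix_mult]
lemmas has_vector_derivative_matrix_vector_mult =
  bounded_bilinear.has_vector_derivative[OF bounded_bilinear_matrix_vector_mult]

lemma has_vector_derivative_vecI:
  fixes f :: "real \<Rightarrow> 'a::euclidean_space^'n"
  assumes "\<And>i. ((\<lambda>t. f t $ i) has_vector_derivative f' $ i) (at t within T)"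
  shows "(f has_vector_derivative f') (at t within T)"
  unfolding has_vector_derivative_def
proof (subst has_derivative_componentwise_within, safe)
  fix b :: "'a^'n" assume "b \<in> Basis"
  then obtain i u where b: "b = axis i u" "u \<in> Basis" by (auto simp: Basis_vec_def)
  have "((\<lambda>t. f t $ i \<bullet> u) has_derivative (\<lambda>x. (x *\<^sub>R f' $ i) \<bullet> u)) (at t within T)"
    using assms[of i] unfolding has_vector_derivative_def by (rule has_derivative_inner_left)
  then show "((\<lambda>x. f x \<bullet> b) has_derivative (\<lambda>x. x *\<^sub>R f' \<bullet> b)) (at t within T)"
    by (simp add: b inner_axis)
qed

lemma has_vector_derivative_matrixI:
  fixes A :: "real \<Rightarrow> real^'n^'m"
  assumes "\<And>i j. ((\<lambda>t. A t $ i $ j) has_real_derivative A' $ i $ j) (at t within T)"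
  shows "(A has_vector_derivative A') (at t within T)"
  using assms by (auto intro!: has_vector_derivative_vecI simp: has_real_derivative_iff_has_vector_derivative)

lemma has_vector_derivative_vec_nth:
  "(f has_vector_derivative f') F \<Longrightarrow> ((\<lambda>t. f t $ i) has_vector_derivative f' $ i) F"
  by (rule bounded_linear.has_vector_derivative[OF bounded_linear_vec_nth])

lemma has_real_derivative_matrix_nth:
  fixes A :: "real \<Rightarrow> real^'n^'m"
  shows "(A has_vector_derivative A') F \<Longrightarrow> ((\<lambda>t. A t $ i $ j) has_real_derivative A' $ i $ j) F"
  unfolding has_real_derivative_iff_has_vector_derivative
  by (intro has_vector_derivative_vec_nth)

text \<open>Agreement is asked for in \<open>nhds t\<close> rather than in a punctured
  neighbourhood, so the values at \<open>t\<close> itself agree as well.\<close>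

lemma has_vector_derivative_transform_at_eventually:
  assumes "(f has_vector_derivative f') (at t)" and "\<forall>\<^sub>F s in nhds t. f s = g s"
  shows "(g has_vector_derivative f') (at t)"
  using assms has_vector_derivative_cong_ev[where f = f and g = g and x = t and S = UNIV and f' = f']
  by (auto dest: eventually_nhds_x_imp_x)

text \<open>The Leibniz sum is a polynomial in the entries. Bare existence of the derivative is
  enough for the Cramer quotients used below for the inverse.\<close>

lemma det_differentiable:
  fixes A :: "real \<Rightarrow> real^'n^'n"
  assumes "\<And>i j. (\<lambda>t. A t $ i $ j) differentiable at t"
  shows "(\<lambda>t. det (A t)) differentiable at t"
proof -
  have A': "((\<lambda>t. A t $ i $ j) has_real_derivative deriv (\<lambda>t. A t $ i $ j) t) (at t)" for i j
    using assms by (simp add: DERIV_deriv_iff_real_differentiable)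
  show ?thesis
    unfolding det_def real_differentiable_def
    by (rule exI, rule DERIV_sum, rule DERIV_cmult, rule has_field_derivative_prod, rule A')
qed

text \<open>Differentiating the Leibniz sum removes one factor from each product. A permutation
  other than \<open>id\<close> moves at least two points, so a zero off-diagonal entry of the
  identity remains in every such product; only \<open>id\<close> contributes, and it gives the
  trace.\<close>

lemma has_real_derivative_det_at_one:
  fixes A :: "real \<Rightarrow> real^'n^'n"
  assumes A: "(A has_vector_derivative A') (at t)" and one: "A t = mat 1"
  shows "((\<lambda>t. det (A t)) has_real_derivative trace A') (at t)"
proof -
  note D = has_real_derivative_matrix_nth[OF A]
  have "((\<lambda>t. det (A t)) has_real_derivative
      (\<Sum>p | p permutes UNIV. of_int (sign p) *
        (\<Sum>i\<in>UNIV. A' $ i $ p i * (\<Prod>j\<in>UNIV - {i}. A t $ j $ p j)))) (at t)"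
    unfolding det_def by (intro DERIV_sum DERIV_cmult has_field_derivative_prod D)
  also have "(\<Sum>p | p permutes UNIV. of_int (sign p) *
        (\<Sum>i\<in>UNIV. A' $ i $ p i * (\<Prod>j\<in>UNIV - {i}. A t $ j $ p j))) =
     (\<Sum>p | p permutes (UNIV::'n set). if p = id then trace A' else 0)"
  proof (intro sum.cong refl)
    fix p :: "'n \<Rightarrow> 'n" assume "p \<in> {p. p permutes UNIV}"
    then have p: "p permutes UNIV" by simp
    have *: "(\<Prod>j\<in>UNIV - {i}. A t $ j $ p j) = 0" if "p \<noteq> id" for i
    proof -
      \<comment> \<open>If \<open>p\<close> fixed every point except possibly \<open>i\<close>,
        injectivity would force it to fix \<open>i\<close> too.\<close>
      obtain j where "j \<noteq> i" "p j \<noteq> j"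
      proof (rule ccontr)
        assume "\<not> thesis"
        with that have fix_off: "\<And>j. j \<noteq> i \<Longrightarrow> p j = j" by metis
        then have "p i = i"
          using permutes_inj[OF p] by (metis injD)
        with fix_off \<open>p \<noteq> id\<close> show False by (metis eq_id_iff)
      qed
      then show ?thesis
        by (auto intro!: prod_zero bexI[of _ j] simp: one mat_def)
    qed
    show "of_int (sign p) * (\<Sum>i\<in>UNIV. A' $ i $ p i * (\<Prod>j\<in>UNIV - {i}. A t $ j $ p j)) =
      (if p = id then trace A' else 0)"
    proof (cases "p = id")
      case False
      then show ?thesis by (simp add: *[OF False])
    qed (simp add: one mat_def trace_def)
  qed
  also have "\<dots> = trace A'"
    by (simp add: sum.delta permutes_id finite_permutations)
  finally show ?thesis .
qed

section \<open>Inverse matrices, Jacobi's formula and the derivative of the inverse\<close>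

lemma matrix_inv_right: "invertible A \<Longrightarrow> A ** matrix_inv A = mat 1"
  and matrix_inv_left: "invertible A \<Longrightarrow> matrix_inv A ** A = mat 1"
  using someI_ex[of "\<lambda>A'. A ** A' = mat 1 \<and> A' ** A = mat 1"]
  unfolding invertible_def matrix_inv_def by simp_all

lemma matrix_inv_eqI:
  fixes A :: "real^'n^'n"
  assumes "A ** B = mat 1"
  shows "matrix_inv A = B"
proof -
  have "invertible A" using assms invertible_right_inverse by blast
  then have "matrix_inv A ** (A ** B) = B"
    by (simp add: matrix_mul_assoc matrix_inv_left)
  then show ?thesis by (simp add: assms)
qed

text \<open>Jacobi's formula: left multiplication by the fixed inverse of \<open>A t\<close> moves
  the base point to the identity, and multiplicativity of the determinant moves it back.\<close>

lemma has_real_derivative_det: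
  fixes A :: "real \<Rightarrow> real^'n^'n"
  assumes A: "(A has_vector_derivative A') (at t)" and inv: "invertible (A t)"
  shows "((\<lambda>t. det (A t)) has_real_derivative det (A t) * trace (matrix_inv (A t) ** A')) (at t)"
proof -
  let ?B = "matrix_inv (A t)"
  have "((\<lambda>s. ?B ** A s) has_vector_derivative ?B ** A') (at t)"
    by (rule bounded_linear.has_vector_derivative[OF
          bounded_bilinear.bounded_linear_right[OF bounded_bilinear_matrix_matrix_mult] A])
  from has_real_derivative_det_at_one[OF this]
  have "((\<lambda>s. det ?B * det (A s)) has_real_derivative trace (?B ** A')) (at t)"
    by (simp add: det_mul matrix_inv_left inv)
  from DERIV_cmult[OF this, of "det (A t)"]
  have "((\<lambda>s. (det (A t) * det ?B) * det (A s)) has_real_derivative det (A t) * trace (?B ** A')) (at t)"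
    by (simp add: mult.assoc)
  moreover have "det (A t) * det ?B = 1"
    using inv by (metis det_mul matrix_inv_right det_I)
  ultimately show ?thesis by simp
qed

text \<open>Cramer's rule writes the inverse near \<open>t\<close> as a matrix of quotients of
  determinants, which settles differentiability. The value then follows by differentiating the
  constant product of the matrix with its inverse.\<close>

lemma has_vector_derivative_matrix_inv:
  fixes A :: "real \<Rightarrow> real^'n^'n"
  assumes A: "(A has_vector_derivative A') (at t)" and inv: "invertible (A t)"
  shows "((\<lambda>t. matrix_inv (A t)) has_vector_derivative
          - (matrix_inv (A t) ** A' ** matrix_inv (A t))) (at t)"
proof -
  \<comment> \<open>Column \<open>l\<close> of \<open>B s\<close> is the Cramer solution of the
    linear system with right-hand side \<open>axis l 1\<close>.\<close>
  define B :: "real \<Rightarrow> real^'n^'n" where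
    "B s = (\<chi> k l. det (\<chi> i j. if j = k then axis l 1 $ i else A s $ i $ j) / det (A s))" for s
  have diff: "(\<lambda>t. A t $ i $ j) differentiable at t" for i j
    using has_real_derivative_matrix_nth[OF A] by (auto simp: real_differentiable_def)
  have det_nz: "det (A t) \<noteq> 0" using inv by (simp add: invertible_det_nz)
  have "isCont (\<lambda>s. det (A s)) t"
    using det_differentiable[OF diff] by (rule differentiable_imp_continuous_within)
  then have ev: "\<forall>\<^sub>F s in nhds t. det (A s) \<noteq> 0"
    unfolding isCont_def tendsto_at_iff_tendsto_nhds[of "\<lambda>s. det (A s)" t]
    by (rule tendsto_imp_eventually_ne[OF _ det_nz])
  have AB: "A s ** B s = mat 1" if "det (A s) \<noteq> 0" for s
  proof -
    have "(A s ** B s) $ i $ l = (mat 1 :: real^'n^'n) $ i $ l" for i l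
    proof -
      have "A s *v (\<chi> k. B s $ k $ l) = axis l 1"
        using cramer[OF that, of "\<chi> k. B s $ k $ l" "axis l 1"] by (simp add: B_def vec_eq_iff)
      then have "(A s *v (\<chi> k. B s $ k $ l)) $ i = (axis l 1 :: real^'n) $ i" by simp
      then show ?thesis
        by (simp add: matrix_matrix_mult_def matrix_vector_mult_def mat_def axis_def)
    qed
    then show ?thesis by (simp add: vec_eq_iff)
  qed
  have B_eq: "\<forall>\<^sub>F s in nhds t. matrix_inv (A s) = B s"
    using ev by eventually_elim (rule matrix_inv_eqI[OF AB])
  have "(\<lambda>s. B s $ k $ l) differentiable at t" for k l
  proof -
    have "(\<lambda>s. if j = k then axis l 1 $ i else A s $ i $ j) differentiable at t" for i j
      by (cases "j = k") (simp_all add: diff)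
    then have "(\<lambda>s. det (\<chi> i j. if j = k then axis l 1 $ i else A s $ i $ j) / det (A s))
        differentiable at t"
      by (intro differentiable_divide det_differentiable diff det_nz) simp
    then show ?thesis by (simp add: B_def)
  qed
  then have B': "((\<lambda>s. B s $ k $ l) has_real_derivative deriv (\<lambda>s. B s $ k $ l) t) (at t)" for k l
    by (simp add: DERIV_deriv_iff_real_differentiable)
  have B: "(B has_vector_derivative (\<chi> k l. deriv (\<lambda>s. B s $ k $ l) t)) (at t)" (is "(B has_vector_derivative ?B') _")
    by (rule has_vector_derivative_matrixI) (simp add: B')
  have "((\<lambda>s. A s ** B s) has_vector_derivative A t ** ?B' + A' ** B t) (at t)"
    by (rule has_vector_derivative_matrix_matrix_mult[OF A B])
  \<comment> \<open>The product is known to be the identity only where the determinant is nonzero,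
    hence near \<open>t\<close>.\<close>
  moreover have "((\<lambda>s. A s ** B s) has_vector_derivative 0) (at t)"
    by (rule has_vector_derivative_transform_at_eventually[of "\<lambda>s. mat 1"])
       (use ev AB in \<open>auto elim: eventually_mono\<close>)
  ultimately have "A t ** ?B' + A' ** B t = 0"
    by (rule vector_derivative_unique_at)
  then have "A t ** ?B' = - (A' ** B t)" by (simp add: eq_neg_iff_add_eq_0)
  then have "matrix_inv (A t) ** (A t ** ?B') = matrix_inv (A t) ** (- (A' ** B t))"
    by simp
  then have "?B' = - (matrix_inv (A t) ** A' ** B t)"
    by (simp add: matrix_mul_assoc matrix_inv_left inv
        bounded_bilinear.minus_right[OF bounded_bilinear_matrix_matrix_mult])
  moreover have "B t = matrix_inv (A t)" using B_eq by (auto dest: eventually_nhds_x_imp_x)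
  ultimately have "(B has_vector_derivative - (matrix_inv (A t) ** A' ** matrix_inv (A t))) (at t)"
    using B by simp
  then show ?thesis
    by (rule has_vector_derivative_transform_at_eventually)
       (use B_eq in \<open>auto elim: eventually_mono\<close>)
qed

section \<open>Positive definite matrices and the Gaussian update\<close>

lemmas matrix_diff_ldistrib = bounded_bilinear.diff_right[OF bounded_bilinear_matrix_matrix_mult]
lemmas matrix_add_rdistrib_real = bounded_bilinear.add_left[OF bounded_bilinear_matrix_matrix_mult]

lemma transpose_add: "transpose (A + B) = transpose A + transpose (B :: real^'n^'m)"
  by (simp add: transpose_def vec_eq_iff)

lemma inner_matrix_vector_mult: "x \<bullet> (A *v y) = (transpose A *v x) \<bullet> (y :: real^'n)"
  by (simp add: dot_lmul_matrix)

section \<open>Positive definite and semidefinite matrices\<close>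

definition pos_def :: "real^'n^'n \<Rightarrow> bool" where
  "pos_def A \<longleftrightarrow> transpose A = A \<and> (\<forall>x. x \<noteq> 0 \<longrightarrow> 0 < x \<bullet> (A *v x))"

definition pos_semidef :: "real^'n^'n \<Rightarrow> bool" where
  "pos_semidef A \<longleftrightarrow> transpose A = A \<and> (\<forall>x. 0 \<le> x \<bullet> (A *v x))"

lemma pos_def_imp_pos_semidef: "pos_def A \<Longrightarrow> pos_semidef A"
  unfolding pos_def_def pos_semidef_def by (metis inner_zero_left less_imp_le order_refl)

lemma pos_def_add: "pos_def A \<Longrightarrow> pos_semidef B \<Longrightarrow> pos_def (A + B)"
  by (auto simp: pos_def_def pos_semidef_def transpose_add matrix_vector_mult_add_rdistrib
      inner_add_right add_pos_nonneg)

lemma pos_semidef_scaleR: "0 \<le> c \<Longrightarrow> pos_semidef A \<Longrightarrow> pos_semidef (c *\<^sub>R A)"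
  by (auto simp: pos_semidef_def transpose_scalar scaleR_matrix_vector_assoc[symmetric])

lemma pos_def_scaleR: "0 < c \<Longrightarrow> pos_def A \<Longrightarrow> pos_def (c *\<^sub>R A)"
  by (auto simp: pos_def_def transpose_scalar scaleR_matrix_vector_assoc[symmetric])

lemma pos_semidef_congruence:
  assumes "pos_semidef A" shows "pos_semidef (B ** A ** transpose B)"
proof -
  have "x \<bullet> ((B ** A ** transpose B) *v x) = (transpose B *v x) \<bullet> (A *v (transpose B *v x))" for x
    unfolding matrix_vector_mul_assoc[symmetric] inner_matrix_vector_mult[of x B] ..
  then show ?thesis
    using assms unfolding pos_semidef_def by (simp add: matrix_transpose_mul matrix_mul_assoc)
qed

lemma pos_def_mat_1: "pos_def (mat 1)"
  by (simp add: pos_def_def)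

lemma pos_def_invertible:
  assumes "pos_def A" shows "invertible A"
proof -
  have "\<forall>x. A *v x = 0 \<longrightarrow> x = 0"
    using assms unfolding pos_def_def by (metis inner_zero_right less_irrefl)
  then show ?thesis
    unfolding invertible_left_inverse matrix_left_invertible_ker .
qed

text \<open>A null vector of a semidefinite form lies in the kernel of the matrix: otherwise a small
  move from \<open>x\<close> against \<open>z = A *v x\<close> would make the form negative.\<close>

lemma pos_semidef_imp_pos_def:
  assumes A: "pos_semidef A" and inv: "invertible A" shows "pos_def A"
proof -
  have sym: "transpose A = A" and nonneg: "\<And>x. 0 \<le> x \<bullet> (A *v x)"
    using A by (auto simp: pos_semidef_def)
  have "A *v x = 0" if x: "x \<bullet> (A *v x) = 0" for x
  proof (rule ccontr)
    assume nz: "A *v x \<noteq> 0"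
    define z where "z = A *v x"
    have zz: "0 < z \<bullet> z" using nz by (simp add: z_def)
    have expand: "(x - c *\<^sub>R z) \<bullet> (A *v (x - c *\<^sub>R z)) = c\<^sup>2 * (z \<bullet> (A *v z)) - 2 * c * (z \<bullet> z)" for c
    proof -
      have "x \<bullet> (A *v z) = z \<bullet> z"
        using inner_matrix_vector_mult[of x A z] by (simp add: sym z_def)
      then show ?thesis
        using x by (simp add: matrix_vector_mult_diff_distrib inner_diff_left inner_diff_right
            matrix_vector_mult_scaleR z_def[symmetric] power2_eq_square algebra_simps)
    qed
    define q where "q = z \<bullet> (A *v z)"
    have q: "0 \<le> q" unfolding q_def by (rule nonneg)
    \<comment> \<open>With this step size \<open>c * q\<close> is at most the squared norm of
      \<open>z\<close>, so the quadratic term cannot offset the linear one. The summand 1 keeps the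
      denominator positive even when \<open>q = 0\<close>.\<close>
    define c where "c = (z \<bullet> z) / (q + 1)"
    have c: "0 < c" using zz q by (simp add: c_def)
    have "c * q \<le> z \<bullet> z" using q zz by (simp add: c_def field_simps)
    then have "c * (c * q) \<le> c * (z \<bullet> z)" using c by (simp add: mult_left_mono)
    moreover have "0 < c * (z \<bullet> z)" using c zz by simp
    ultimately have "c\<^sup>2 * q - 2 * c * (z \<bullet> z) < 0"
      by (simp add: power2_eq_square mult.assoc)
    with nonneg[of "x - c *\<^sub>R z"] show False by (simp add: expand q_def)
  qed
  moreover have "x = 0" if "A *v x = 0" for x
    using inv that unfolding invertible_left_inverse matrix_left_invertible_ker by blast
  ultimately have "0 < x \<bullet> (A *v x)" if "x \<noteq> 0" for x
    using that nonneg[of x] by (metis order_le_less)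
  then show ?thesis using sym by (simp add: pos_def_def)
qed

text \<open>Substituting \<open>x = A *v z\<close> turns the form of the inverse at \<open>x\<close>
  into the form of \<open>A\<close> at \<open>z\<close>.\<close>

lemma pos_def_matrix_inv:
  assumes A: "pos_def A" shows "pos_def (matrix_inv A)"
proof -
  note inv = pos_def_invertible[OF A]
  have sym: "transpose A = A" using A by (simp add: pos_def_def)
  have "A ** transpose (matrix_inv A) = mat 1"
    using arg_cong[OF matrix_inv_left[OF inv], of transpose]
    by (simp add: matrix_transpose_mul sym)
  then have sym': "transpose (matrix_inv A) = matrix_inv A"
    using matrix_inv_eqI by metis
  have "0 < x \<bullet> (matrix_inv A *v x)" if "x \<noteq> 0" for x
  proof -
    define z where "z = matrix_inv A *v x"
    have x: "x = A *v z" by (simp add: z_def matrix_vector_mul_assoc matrix_inv_right inv)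
    then have "z \<noteq> 0" using that by auto
    then have "0 < z \<bullet> (A *v z)" using A by (simp add: pos_def_def)
    then show ?thesis by (simp add: x[symmetric] z_def[symmetric] inner_commute)
  qed
  with sym' show ?thesis by (simp add: pos_def_def)
qed

lemma matrix_inv_matrix_inv: "invertible A \<Longrightarrow> matrix_inv (matrix_inv A) = (A :: real^'n^'n)"
  by (intro matrix_inv_eqI matrix_inv_left)

lemma has_vector_derivative_affine:
  fixes A B :: "'a::real_normed_vector"
  shows "((\<lambda>t. A + t *\<^sub>R B) has_vector_derivative B) (at t)"
  by (auto intro!: derivative_eq_intros)

text \<open>The segment from the identity to \<open>A\<close> stays among positive definite, hence
  invertible, matrices. The determinant starts at 1 and cannot cross zero along it.\<close>

lemma pos_def_det_pos:
  assumes A: "pos_def (A :: real^'n^'n)" shows "0 < det A"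
proof (rule ccontr)
  assume neg: "\<not> 0 < det A"
  define M where "M t = mat 1 + t *\<^sub>R (A - mat 1)" for t
  have M: "pos_def (M t)" if "0 \<le> t" "t \<le> 1" for t
  proof (cases "t = 1")
    case True then show ?thesis by (simp add: M_def A)
  next
    case False
    have "pos_def ((1 - t) *\<^sub>R mat 1 + t *\<^sub>R A)"
      using that False A
      by (intro pos_def_add pos_def_scaleR pos_semidef_scaleR pos_def_imp_pos_semidef pos_def_mat_1) auto
    then show ?thesis by (simp add: M_def algebra_simps)
  qed
  \<comment> \<open>Continuity is read off from Jacobi's formula, which applies because every
    \<open>M t\<close> on the segment is invertible.\<close>
  have "\<forall>t. 0 \<le> t \<and> t \<le> 1 \<longrightarrow> isCont (\<lambda>t. det (M t)) t"
    using has_real_derivative_det[OF has_vector_derivative_affine] M[THEN pos_def_invertible] DERIV_isCont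
    unfolding M_def by blast
  then have "\<exists>t\<ge>0. t \<le> 1 \<and> det (M t) = 0"
    by (intro IVT2) (use neg in \<open>auto simp: M_def\<close>)
  then show False
    using M[THEN pos_def_invertible] by (metis invertible_det_nz)
qed

lemma ln_det_matrix_inv:
  assumes "pos_def A" shows "ln (det (matrix_inv A)) = - ln (det A)"
proof -
  have "det A * det (matrix_inv A) = 1"
    using arg_cong[OF matrix_inv_right[OF pos_def_invertible[OF assms]], of det] by (simp add: det_mul)
  then have "det (matrix_inv A) = inverse (det A)"
    using inverse_unique[of "det A" "det (matrix_inv A)"] by simp
  then show ?thesis using pos_def_det_pos[OF assms] by (simp add: ln_inverse)
qed

text \<open>One Bayesian update for a linear Gaussian observation: prior covariance
  \<open>P\<close>, observation matrix \<open>H\<close>, noise covariance \<open>V\<close>. Below,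
  \<open>innovation\<close> is the predictive covariance and \<open>information\<close> the
  posterior precision.\<close>

locale kalman_update =
  fixes H :: "real^'m^'n" and P :: "real^'m^'m" and V :: "real^'n^'n"
  assumes P: "pos_def P" and V: "pos_def V"
begin

definition "innovation = H ** P ** transpose H + V"
definition "gain = P ** transpose H ** matrix_inv innovation"
definition "information = matrix_inv P + transpose H ** matrix_inv V ** H"

lemmas P_inv = pos_def_invertible[OF P] and V_inv = pos_def_invertible[OF V]

lemma innovation_pos_def: "pos_def innovation"
  unfolding innovation_def
  by (subst add.commute) (intro pos_def_add V pos_semidef_congruence pos_def_imp_pos_semidef P)

lemma information_pos_def: "pos_def information"
  unfolding information_def
  using pos_semidef_congruence[OF pos_def_imp_pos_semidef[OF pos_def_matrix_inv[OF V]], of "transpose H"]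
  by (intro pos_def_add pos_def_matrix_inv P) simp

text \<open>Push-through identity: both sides expand to \<open>transpose H\<close> plus
  \<open>transpose H ** matrix_inv V ** H ** P ** transpose H\<close>.\<close>

lemma information_mult_cross_cov:
  "information ** (P ** transpose H) = transpose H ** matrix_inv V ** innovation"
proof -
  have "information ** (P ** transpose H) =
      (matrix_inv P ** P) ** transpose H + transpose H ** matrix_inv V ** (H ** P ** transpose H)"
    by (simp only: information_def matrix_add_rdistrib_real matrix_mul_assoc)
  also have "\<dots> = transpose H ** matrix_inv V ** (H ** P ** transpose H)
      + transpose H ** (matrix_inv V ** V)"
    by (simp add: matrix_inv_left P_inv V_inv)
  also have "\<dots> = transpose H ** matrix_inv V ** innovation"
    by (simp only: innovation_def matrix_add_ldistrib matrix_mul_assoc)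
  finally show ?thesis .
qed

lemma information_mult_gain: "information ** gain = transpose H ** matrix_inv V"
proof -
  have "information ** gain = (information ** (P ** transpose H)) ** matrix_inv innovation"
    by (simp only: gain_def matrix_mul_assoc)
  also have "\<dots> = transpose H ** matrix_inv V ** (innovation ** matrix_inv innovation)"
    unfolding information_mult_cross_cov by (simp only: matrix_mul_assoc)
  finally show ?thesis
    by (simp add: matrix_inv_right pos_def_invertible innovation_pos_def)
qed

lemma gain_mult_innovation: "gain ** innovation = P ** transpose H"
  unfolding gain_def matrix_mul_assoc[symmetric]
  by (simp add: matrix_inv_left pos_def_invertible innovation_pos_def)

text \<open>Woodbury's identity, verified by multiplying the left side by \<open>information\<close>
  and applying the information form of the gain.\<close>

lemma posterior_cov:
  "P - gain ** innovation ** transpose gain = matrix_inv information"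
proof -
  have sym: "transpose P = P" "transpose (matrix_inv innovation) = matrix_inv innovation"
    using P pos_def_matrix_inv[OF innovation_pos_def] by (simp_all add: pos_def_def)
  have "gain ** innovation ** transpose gain = gain ** (H ** P)"
    unfolding gain_mult_innovation by (simp add: gain_def matrix_transpose_mul sym matrix_mul_assoc)
  moreover have "information ** (P - gain ** (H ** P)) = mat 1"
  proof -
    have "information ** (P - gain ** (H ** P)) =
        information ** P - (information ** gain) ** (H ** P)"
      by (simp only: matrix_diff_ldistrib matrix_mul_assoc)
    also have "\<dots> = matrix_inv P ** P"
      unfolding information_mult_gain
      by (simp add: information_def matrix_add_rdistrib_real matrix_mul_assoc)
    finally show ?thesis by (simp add: matrix_inv_left P_inv)
  qed
  ultimately show ?thesis by (metis matrix_inv_eqI)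
qed

text \<open>Information vectors add: \<open>information\<close> exceeds the prior precision by
  exactly the term that cancels the contribution of \<open>H *v m\<close> in the residual.\<close>

lemma posterior_mean:
  "information *v (m + gain *v (y - H *v m)) = matrix_inv P *v m + (transpose H ** matrix_inv V) *v y"
proof -
  have "information *v (m + gain *v (y - H *v m)) =
      information *v m + (information ** gain) *v (y - H *v m)"
    by (simp only: matrix_vector_right_distrib matrix_vector_mul_assoc)
  also have "\<dots> = matrix_inv P *v m + (transpose H ** matrix_inv V) *v y"
    unfolding information_mult_gain
    by (simp add: information_def matrix_vector_mult_add_rdistrib matrix_vector_mult_diff_distrib
        matrix_vector_mul_assoc del: transpose_matrix_vector)
  finally show ?thesis .
qed

text \<open>Completion of the square. The posterior terms have the form of a potential, so they
  cancel between consecutive updates.\<close>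

lemma innovation_quadratic_form:
  assumes m': "m' = m + gain *v (y - H *v m)"
  shows "(y - H *v m) \<bullet> (matrix_inv innovation *v (y - H *v m)) =
    y \<bullet> (matrix_inv V *v y) + m \<bullet> (matrix_inv P *v m) - m' \<bullet> (information *v m')"
proof -
  \<comment> \<open>The normalized innovation \<open>s\<close> satisfies
    \<open>V *v s = y - H *v m'\<close> and \<open>P *v (transpose H *v s) = m' - m\<close>. These
    two relations eliminate \<open>innovation\<close> from the inner products of \<open>s\<close>
    with \<open>y\<close> and with \<open>H *v m\<close>.\<close>
  define s where "s = matrix_inv innovation *v (y - H *v m)"
  have symP: "transpose (matrix_inv P) = matrix_inv P" and symV: "transpose (matrix_inv V) = matrix_inv V"
    using pos_def_matrix_inv[OF P] pos_def_matrix_inv[OF V] by (simp_all add: pos_def_def)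
  have Ht: "P *v (transpose H *v s) = gain *v (y - H *v m)"
    by (simp only: s_def gain_def matrix_vector_mul_assoc matrix_mul_assoc)
  have "innovation *v s = y - H *v m"
    by (simp add: s_def matrix_vector_mul_assoc matrix_inv_right pos_def_invertible innovation_pos_def)
  then have "H *v (gain *v (y - H *v m)) + V *v s = y - H *v m"
    by (simp add: innovation_def matrix_vector_mult_add_rdistrib Ht[symmetric] matrix_vector_mul_assoc
        matrix_mul_assoc del: transpose_matrix_vector)
  then have "V *v s = y - H *v m'"
    by (simp add: m' matrix_vector_right_distrib algebra_simps)
  then have s: "s = matrix_inv V *v y - matrix_inv V *v (H *v m')"
    by (metis matrix_inv_left[OF V_inv] matrix_vector_mul_assoc matrix_vector_mul_lid matrix_vector_mult_diff_distrib)
  have "P *v (transpose H *v s) = m' - m" by (simp only: Ht m') simp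
  then have Hs: "transpose H *v s = matrix_inv P *v m' - matrix_inv P *v m"
    by (metis matrix_inv_left[OF P_inv] matrix_vector_mul_assoc matrix_vector_mul_lid matrix_vector_mult_diff_distrib)
  have "information *v m' = matrix_inv P *v m + transpose H *v (matrix_inv V *v y)"
    unfolding m' posterior_mean by (simp only: matrix_vector_mul_assoc)
  then have "m' \<bullet> (information *v m') = m' \<bullet> (matrix_inv P *v m) + (H *v m') \<bullet> (matrix_inv V *v y)"
    using inner_matrix_vector_mult[of m' "transpose H" "matrix_inv V *v y"]
    by (simp only: inner_add_right transpose_transpose)
  moreover have "m' \<bullet> (matrix_inv P *v m) = m \<bullet> (matrix_inv P *v m')"
    using inner_matrix_vector_mult[of m' "matrix_inv P" m] by (simp only: symP inner_commute)
  moreover have "(H *v m') \<bullet> (matrix_inv V *v y) = y \<bullet> (matrix_inv V *v (H *v m'))"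
    using inner_matrix_vector_mult[of "H *v m'" "matrix_inv V" y] by (simp only: symV inner_commute)
  moreover have "(H *v m) \<bullet> s = m \<bullet> (matrix_inv P *v m') - m \<bullet> (matrix_inv P *v m)"
    using inner_matrix_vector_mult[of m "transpose H" s] by (simp only: transpose_transpose Hs inner_diff_right)
  moreover have "y \<bullet> s = y \<bullet> (matrix_inv V *v y) - y \<bullet> (matrix_inv V *v (H *v m'))"
    by (simp only: s inner_diff_right)
  ultimately show ?thesis
    unfolding s_def[symmetric] inner_diff_left by simp
qed

end

text \<open>
  Scaling both rank corrections by \<open>t\<close>, from \<open>0\<close> to \<open>1\<close>, Jacobi's formula gives the two logarithmic
  determinants the same derivative, because their traces agree cyclically.  This avoids block
  determinants, which would need matrices indexed by a sum type.
\<close>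

lemma (in kalman_update) ln_det_innovation:
  "ln (det innovation) = ln (det V) + ln (det information) + ln (det P)"
proof -
  define C where "C = H ** P ** transpose H"
  define N where "N = transpose H ** matrix_inv V ** H"
  define f where "f t = ln (det (V + t *\<^sub>R C)) - ln (det (matrix_inv P + t *\<^sub>R N))" for t
  have pd: "pos_def (V + t *\<^sub>R C)" "pos_def (matrix_inv P + t *\<^sub>R N)" if "0 \<le> t" for t
    using that pos_semidef_congruence[OF pos_def_imp_pos_semidef[OF P], of H]
      pos_semidef_congruence[OF pos_def_imp_pos_semidef[OF pos_def_matrix_inv[OF V]], of "transpose H"]
    by (auto intro!: pos_def_add pos_semidef_scaleR V P pos_def_matrix_inv simp: C_def N_def)
  have deriv: "(f has_real_derivative 0) (at t)" if t: "0 \<le> t" for t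
  proof -
    let ?S = "V + t *\<^sub>R C" and ?I = "matrix_inv P + t *\<^sub>R N"
    have inv: "invertible ?S" "invertible ?I" using pd[OF t] by (auto intro: pos_def_invertible)
    \<comment> \<open>The push-through identity holds along the whole path, because \<open>C\<close>
      and \<open>N\<close> carry the same factor \<open>t\<close>.\<close>
    have "?I ** (P ** transpose H) = transpose H ** matrix_inv V ** ?S"
    proof -
      have "?I ** (P ** transpose H) = (matrix_inv P ** P) ** transpose H + t *\<^sub>R (transpose H ** matrix_inv V ** C)"
        by (simp only: N_def C_def matrix_add_rdistrib_real matrix_mul_assoc scalar_matrix_assoc)
      also have "\<dots> = transpose H ** (matrix_inv V ** V) + t *\<^sub>R (transpose H ** matrix_inv V ** C)"
        by (simp add: matrix_inv_left P_inv V_inv)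
      also have "\<dots> = transpose H ** matrix_inv V ** ?S"
        by (simp only: matrix_add_ldistrib matrix_mul_assoc matrix_scalar_ac scalar_matrix_assoc)
      finally show ?thesis .
    qed
    then have "matrix_inv ?I ** (?I ** (P ** transpose H)) ** matrix_inv ?S =
        matrix_inv ?I ** (transpose H ** matrix_inv V ** ?S) ** matrix_inv ?S"
      by simp
    then have "(matrix_inv ?I ** ?I) ** (P ** transpose H) ** matrix_inv ?S =
        matrix_inv ?I ** transpose H ** matrix_inv V ** (?S ** matrix_inv ?S)"
      by (simp only: matrix_mul_assoc)
    then have "P ** transpose H ** matrix_inv ?S = matrix_inv ?I ** transpose H ** matrix_inv V"
      by (simp add: matrix_inv_left matrix_inv_right inv)
    then have "trace (matrix_inv ?I ** N) = trace (P ** transpose H ** matrix_inv ?S ** H)"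
      by (simp add: N_def matrix_mul_assoc)
    also have "\<dots> = trace (H ** (P ** transpose H ** matrix_inv ?S))"
      by (rule trace_mul_sym)
    also have "\<dots> = trace (C ** matrix_inv ?S)"
      by (simp only: C_def matrix_mul_assoc)
    also have "\<dots> = trace (matrix_inv ?S ** C)"
      by (rule trace_mul_sym)
    finally have tr: "trace (matrix_inv ?I ** N) = trace (matrix_inv ?S ** C)" .
    have "0 < det ?S" "0 < det ?I" using pd[OF t] by (auto intro: pos_def_det_pos)
    then show ?thesis
      unfolding f_def
      by (auto intro!: derivative_eq_intros has_real_derivative_det[OF has_vector_derivative_affine] inv simp: tr)
  qed
  \<comment> \<open>At 1 the path reaches \<open>innovation\<close> and \<open>information\<close>;
    at 0 it leaves \<open>V\<close> and \<open>matrix_inv P\<close>, whose logarithmic determinant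
    is minus that of \<open>P\<close>.\<close>
  have "f 1 = f 0"
  proof (rule DERIV_isconst_end[of 0 1 f])
    show "continuous_on {0..1} f"
      using deriv by (meson DERIV_isCont atLeastAtMost_iff continuous_at_imp_continuous_on)
  qed (use deriv in auto)
  then show ?thesis
    by (simp add: f_def C_def N_def innovation_def information_def add.commute ln_det_matrix_inv P)
qed

section \<open>Information form of the recursive bound\<close>

lemma det_diag_matrix: "det (\<chi> i j. if i = j then c i else (0 :: real)) = (\<Prod>i\<in>UNIV. c i)"
  by (subst det_diagonal) auto

lemma matrix_mult_diag_matrix:
  "A ** (\<chi> i j. if i = j then c i else (0::real)) = (\<chi> i j. A $ i $ j * c j)"
proof -
  have "A $ i $ k * (if k = j then c k else 0) = (if k = j then A $ i $ j * c j else 0)" for i j k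
    by simp
  then show ?thesis by (simp only: matrix_matrix_mult_def vec_lambda_beta) simp
qed

lemma diag_matrix_mult_vec:
  "(\<chi> i j. if i = j then c i else (0::real)) *v x = (\<chi> i. c i * x $ i)"
proof -
  have "(if i = j then c i else 0) * x $ j = (if i = j then c i * x $ i else 0)" for i j
    by simp
  then show ?thesis by (simp only: matrix_vector_mult_def vec_lambda_beta) simp
qed

lemma matrix_inv_diag_matrix:
  assumes "\<And>i. c i \<noteq> 0"
  shows "matrix_inv (\<chi> i j. if i = j then c i else 0) = (\<chi> i j. if i = j then 1 / c i else (0::real))"
  using assms by (intro matrix_inv_eqI) (simp add: matrix_mult_diag_matrix mat_def vec_eq_iff)

lemma pos_def_diag_matrix:
  fixes c :: "'n::finite \<Rightarrow> real"
  assumes "\<And>i. 0 < c i"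
  shows "pos_def (\<chi> i j. if i = j then c i else (0::real))"
proof -
  have "0 < (\<Sum>i\<in>UNIV. c i * (x $ i)\<^sup>2)" if nz: "x \<noteq> 0" for x :: "real^'n"
  proof -
    obtain i where "x $ i \<noteq> 0" using nz by (auto simp: vec_eq_iff)
    then show ?thesis
      using assms by (intro sum_pos2[of _ i]) (simp_all add: less_imp_le)
  qed
  then have "0 < (\<Sum>i\<in>UNIV. x $ i * (c i * x $ i))" if "x \<noteq> 0" for x :: "real^'n"
    using that by (simp add: power2_eq_square mult.left_commute)
  then show ?thesis
    unfolding pos_def_def diag_matrix_mult_vec by (simp add: transpose_def vec_eq_iff inner_vec_def)
qed

text \<open>An enumeration of \<open>I\<close> transfers the defining inequality, stated for points
  numbered by naturals, to arbitrary finite index sets.\<close>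

lemma pos_def_kernel_sum_nonneg:
  fixes c :: "'i \<Rightarrow> real"
  assumes k: "pos_def_kernel k" and fin: "finite I"
  shows "0 \<le> (\<Sum>i\<in>I. \<Sum>j\<in>I. c i * c j * k (x i) (x j))"
proof -
  obtain f where f: "bij_betw f {0..<card I} I"
    using ex_bij_betw_nat_finite[OF fin] by blast
  have "(\<Sum>i\<in>I. \<Sum>j\<in>I. c i * c j * k (x i) (x j)) =
      (\<Sum>i<card I. \<Sum>j<card I. c (f i) * c (f j) * k (x (f i)) (x (f j)))"
    by (simp add: sum.reindex_bij_betw[OF f, symmetric] lessThan_atLeast0)
  also have "\<dots> \<ge> 0"
    using k unfolding pos_def_kernel_def by auto
  finally show ?thesis .
qed

text \<open>The option type serves to adjoin one test input to the inducing inputs.\<close>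

lemma sum_UNIV_option: "(\<Sum>i\<in>UNIV. f i) = f None + (\<Sum>j\<in>UNIV. f (Some j))"
  for f :: "'i::finite option \<Rightarrow> 'r::comm_monoid_add"
  by (simp add: UNIV_option_conv sum.reindex)

section \<open>Consecutive mini-batches and the Gaussian log-density\<close>

lemma bij_betw_card_lessThan: "bij_betw (\<lambda>b. card {..<b}) (UNIV :: 'b::{finite,linorder} set) {..<CARD('b)}"
proof (rule bij_betw_imageI)
  have mono: "strict_mono (\<lambda>b::'b. card {..<b})"
    by (intro strict_monoI psubset_card_mono) auto
  show inj: "inj (\<lambda>b::'b. card {..<b})"
    by (rule strict_mono_imp_inj_on[OF mono])
  have sub: "range (\<lambda>b::'b. card {..<b}) \<subseteq> {..<CARD('b)}"
    by (auto intro!: psubset_card_mono)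
  show "range (\<lambda>b::'b. card {..<b}) = {..<CARD('b)}"
    by (rule card_subset_eq[OF _ sub]) (simp_all add: card_image[OF inj])
qed

text \<open>The \<open>K\<close> blocks of consecutive positions tile all positions exactly once.
  The summand takes an input together with its target, so their pairing is kept, and its values may
  be scalars, vectors or matrices.\<close>

lemma sum_mini_batch:
  fixes f :: "'a \<Rightarrow> 'c \<Rightarrow> 'r::comm_monoid_add"
    and X :: "'a^'n::{finite,linorder}" and Y :: "'c^'n::{finite,linorder}"
  assumes card: "CARD('n) = K * CARD('b)"
  shows "(\<Sum>k=1..K. \<Sum>b\<in>UNIV. f (mini_batch X k $ (b::'b::{finite,linorder})) (mini_batch Y k $ b)) =
    (\<Sum>n\<in>UNIV. f (X $ n) (Y $ n))"
proof -
  let ?B = "CARD('b)" and ?l = "sorted_list_of_set (UNIV :: 'n set)"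
  define g where "g m = f (X $ (?l ! m)) (Y $ (?l ! m))" for m
  have "(\<Sum>k=1..K. \<Sum>b\<in>UNIV. f (mini_batch X k $ (b::'b)) (mini_batch Y k $ b)) =
      (\<Sum>k=1..K. \<Sum>j<?B. g ((k - 1) * ?B + j))"
    unfolding sum.reindex_bij_betw[OF bij_betw_card_lessThan, symmetric]
    by (simp add: mini_batch_def g_def)
  \<comment> \<open>Shift from batches counted from 1 to blocks counted from 0.\<close>
  also have "\<dots> = (\<Sum>k<K. \<Sum>j<?B. g (j + k * ?B))"
    by (rule sum.reindex_bij_witness[of _ Suc "\<lambda>k. k - 1"]) (auto simp: add.commute)
  also have "\<dots> = sum g {..<K * ?B}"
    unfolding sum.nat_group[symmetric]
  proof (rule sum.cong[OF refl])
    fix k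
    show "(\<Sum>j<?B. g (j + k * ?B)) = sum g {k * ?B..<k * ?B + ?B}"
      using sum.shift_bounds_nat_ivl[of g 0 "k * ?B" ?B] by (simp add: lessThan_atLeast0 add.commute)
  qed
  also have "\<dots> = (\<Sum>n\<in>UNIV. f (X $ n) (Y $ n))"
  proof -
    have "bij_betw ((!) ?l) {..<length ?l} (set ?l)"
      by (rule bij_betw_nth) auto
    then have "bij_betw ((!) ?l) {..<K * ?B} UNIV"
      by (simp add: card[symmetric])
    from sum.reindex_bij_betw[OF this, of "\<lambda>n. f (X $ n) (Y $ n)"]
    show ?thesis by (simp add: g_def)
  qed
  finally show ?thesis .
qed

lemma ln_gauss_density:
  fixes y m :: "real^'n"
  assumes "0 < det C"
  shows "ln (gauss_density y m C) =
    - (1/2) * (CARD('n) * ln (2 * pi) + ln (det C) + (y - m) \<bullet> (matrix_inv C *v (y - m)))"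
proof -
  define c where "c = (2 * pi) ^ CARD('n) * det C"
  have c: "0 < c" "ln c = CARD('n) * ln (2 * pi) + ln (det C)"
    using assms by (simp_all add: c_def ln_mult_pos ln_realpow distrib_left)
  have ln_ratio: "ln (exp q / sqrt c) = q - ln c / 2" for q
    using c(1) by (simp add: ln_div ln_sqrt)
  then show ?thesis
    unfolding gauss_density_def c_def[symmetric] ln_ratio c(2) by (simp add: field_simps)
qed

section \<open>Contributions of single observations\<close>

context sparse_gp
begin

text \<open>The row that an input \<open>x\<close> contributes to the observation matrix
  \<open>H\<close>. Likewise \<open>resid_var\<close> and \<open>noise_var\<close> are the diagonal
  entries that \<open>x\<close> contributes to \<open>Dmat\<close> and \<open>V\<close>.\<close>

definition feature :: "('p, 'd, 'm::finite) params \<Rightarrow> real^'d \<Rightarrow> real^'m" where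
  "feature \<eta> x = (\<chi> j. \<Sum>l\<in>UNIV. \<kappa> (hyper \<eta>) x (inducing \<eta> $ l) * matrix_inv (KRR \<eta>) $ l $ j)"

definition resid_var :: "('p, 'd, 'm::finite) params \<Rightarrow> real^'d \<Rightarrow> real" where
  "resid_var \<eta> x = \<kappa> (hyper \<eta>) x x - (\<Sum>j\<in>UNIV. feature \<eta> x $ j * \<kappa> (hyper \<eta>) (inducing \<eta> $ j) x)"

definition noise_var :: "('p, 'd, 'm::finite) params \<Rightarrow> real^'d \<Rightarrow> real" where
  "noise_var \<eta> x = \<alpha> * resid_var \<eta> x + (noise \<eta>)\<^sup>2"

definition datum_info :: "('p, 'd, 'm::finite) params \<Rightarrow> real^'d \<Rightarrow> real^'m^'m" where
  "datum_info \<eta> x = (\<chi> i j. feature \<eta> x $ i * feature \<eta> x $ j / noise_var \<eta> x)"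

definition datum_score :: "('p, 'd, 'm::finite) params \<Rightarrow> real^'d \<Rightarrow> real \<Rightarrow> real^'m" where
  "datum_score \<eta> x u = (\<chi> i. feature \<eta> x $ i * u / noise_var \<eta> x)"

text \<open>The part of the bound that is additive over observations, scaled by -2: normalizing
  constant, log-determinant and quadratic form of the diagonal noise, and the PEP
  correction.\<close>

definition datum_cost :: "('p, 'd, 'm::finite) params \<Rightarrow> real^'d \<Rightarrow> real \<Rightarrow> real" where
  "datum_cost \<eta> x u = ln (2 * pi) + ln (noise_var \<eta> x) + u\<^sup>2 / noise_var \<eta> x
     + (1 - \<alpha>) / \<alpha> * ln (1 + \<alpha> / (noise \<eta>)\<^sup>2 * resid_var \<eta> x)"

text \<open>The bound as a function of three accumulated sums: costs \<open>c\<close>, precisions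
  \<open>J\<close> and information vectors \<open>s\<close>. No grouping into batches is visible in
  it.\<close>

definition information_bound ::
    "('p, 'd, 'm::finite) params \<Rightarrow> real \<Rightarrow> real^'m^'m \<Rightarrow> real^'m \<Rightarrow> real" where
  "information_bound \<eta> c J s = - (1/2) * (c + ln (det (matrix_inv (KRR \<eta>) + J)) + ln (det (KRR \<eta>))
     - s \<bullet> (matrix_inv (matrix_inv (KRR \<eta>) + J) *v s))"

lemma Kmat_KRR_inv_nth: "(Kmat \<eta> A (inducing \<eta>) ** matrix_inv (KRR \<eta>)) $ i = feature \<eta> (A $ i)"
  by (simp add: feature_def Kmat_def matrix_matrix_mult_def vec_eq_iff)

lemma Dmat_diag: "Dmat \<eta> A $ i $ i = resid_var \<eta> (A $ i)"
  by (simp add: Dmat_def Qmat_def resid_var_def Kmat_KRR_inv_nth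
      matrix_matrix_mult_def[of "Kmat \<eta> A (inducing \<eta>) ** matrix_inv (KRR \<eta>)"])
     (simp add: Kmat_def)

end

text \<open>The assumptions do not mention the data, so the locale predicate takes only the kernel,
  \<open>\<alpha>\<close> and \<open>\<Theta>\<close>. The same fact thus serves the full data set
  and the mini-batches.\<close>

locale pep_regular = pep_recursion \<kappa> \<alpha> Xs ys
  for \<kappa> :: "('p::finite, 'd::finite) kernel" and \<alpha> :: real
    and Xs :: "nat \<Rightarrow> real^'d^'b::finite" and ys :: "nat \<Rightarrow> real^'b" +
  fixes \<Theta> :: "('p, 'd, 'm::finite) params set"
  assumes \<alpha>_pos: "0 < \<alpha>"
    and open_\<Theta>: "open \<Theta>"
    and noise_pos: "\<eta> \<in> \<Theta> \<Longrightarrow> 0 < noise \<eta>"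
    and kernel: "\<eta> \<in> \<Theta> \<Longrightarrow> pos_def_kernel (\<kappa> (hyper \<eta>))"
    and kernel_differentiable:
      "\<eta> \<in> \<Theta> \<Longrightarrow> (\<lambda>(h, u, v). \<kappa> h u v) differentiable (at (hyper \<eta>, x, x'))"
    and KRR_invertible: "\<eta> \<in> \<Theta> \<Longrightarrow> invertible (KRR \<eta>)"
begin

section \<open>Positivity on the parameter set\<close>

lemma kernel_sym: "\<eta> \<in> \<Theta> \<Longrightarrow> \<kappa> (hyper \<eta>) x x' = \<kappa> (hyper \<eta>) x' x"
  using kernel unfolding pos_def_kernel_def by blast

lemma KRR_pos_def:
  assumes \<eta>: "\<eta> \<in> \<Theta>" shows "pos_def (KRR \<eta>)"
proof (rule pos_semidef_imp_pos_def[OF _ KRR_invertible[OF \<eta>]])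
  have "0 \<le> w \<bullet> (KRR \<eta> *v w)" for w
    using pos_def_kernel_sum_nonneg[OF kernel[OF \<eta>], of UNIV "($) w" "($) (inducing \<eta>)"]
    by (simp add: KRR_def Kmat_def inner_vec_def matrix_vector_mult_def sum_distrib_left mult_ac)
  then show "pos_semidef (KRR \<eta>)"
    by (simp add: pos_semidef_def KRR_def Kmat_def transpose_def vec_eq_iff kernel_sym[OF \<eta>])
qed

text \<open>A Schur complement: it is the kernel form on \<open>x\<close> and the inducing inputs,
  with weight 1 at \<open>x\<close> and minus the entries of \<open>feature\<close>
  elsewhere.\<close>

lemma resid_var_nonneg:
  assumes \<eta>: "\<eta> \<in> \<Theta>" shows "0 \<le> resid_var \<eta> x"
proof -
  define w where "w = feature \<eta> x"
  define u where "u = (\<chi> j. \<kappa> (hyper \<eta>) x (inducing \<eta> $ j))"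
  have sym: "transpose (matrix_inv (KRR \<eta>)) = matrix_inv (KRR \<eta>)"
    using pos_def_matrix_inv[OF KRR_pos_def[OF \<eta>]] by (simp add: pos_def_def)
  have "w = transpose (matrix_inv (KRR \<eta>)) *v u"
    by (simp add: w_def feature_def u_def vector_matrix_mult_def mult.commute)
  then have Kw: "KRR \<eta> *v w = u"
    by (simp add: sym matrix_vector_mul_assoc matrix_inv_right KRR_invertible[OF \<eta>] del: transpose_matrix_vector)
  \<comment> \<open>\<open>None\<close> indexes the test input \<open>x\<close>,
    \<open>Some j\<close> the \<open>j\<close>-th inducing input.\<close>
  define c where "c i = (case i of None \<Rightarrow> 1 | Some j \<Rightarrow> - w $ j)" for i
  define z where "z i = (case i of None \<Rightarrow> x | Some j \<Rightarrow> inducing \<eta> $ j)" for i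
  let ?k = "\<kappa> (hyper \<eta>)"
  have "0 \<le> (\<Sum>i\<in>UNIV. \<Sum>j\<in>UNIV. c i * c j * ?k (z i) (z j))"
    by (rule pos_def_kernel_sum_nonneg[OF kernel[OF \<eta>]]) simp
  also have "\<dots> = ?k x x - (\<Sum>j\<in>UNIV. w $ j * ?k x (inducing \<eta> $ j))
      - (\<Sum>i\<in>UNIV. w $ i * ?k (inducing \<eta> $ i) x)
      + (\<Sum>i\<in>UNIV. \<Sum>j\<in>UNIV. w $ i * w $ j * ?k (inducing \<eta> $ i) (inducing \<eta> $ j))"
    by (simp add: sum_UNIV_option c_def z_def sum.distrib sum_negf sum_subtractf)
  also have "(\<Sum>j\<in>UNIV. w $ j * ?k x (inducing \<eta> $ j)) = w \<bullet> u"
    by (simp add: inner_vec_def u_def)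
  also have "(\<Sum>i\<in>UNIV. \<Sum>j\<in>UNIV. w $ i * w $ j * ?k (inducing \<eta> $ i) (inducing \<eta> $ j)) = w \<bullet> (KRR \<eta> *v w)"
    by (simp add: inner_vec_def KRR_def Kmat_def matrix_vector_mult_def sum_distrib_left mult_ac)
  \<comment> \<open>Because \<open>KRR\<close> maps \<open>w\<close> to \<open>u\<close>, the last
    term cancels one of the two cross terms.\<close>
  also have "?k x x - w \<bullet> u - (\<Sum>i\<in>UNIV. w $ i * ?k (inducing \<eta> $ i) x) + w \<bullet> (KRR \<eta> *v w) = resid_var \<eta> x"
    unfolding Kw by (simp add: resid_var_def w_def)
  finally show ?thesis .
qed

lemma noise_var_pos: "\<eta> \<in> \<Theta> \<Longrightarrow> 0 < noise_var \<eta> x"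
  unfolding noise_var_def using resid_var_nonneg[of \<eta> x] noise_pos[of \<eta>] \<alpha>_pos
  by (intro add_nonneg_pos mult_nonneg_nonneg) auto

lemma noise_var_nonzero: "\<eta> \<in> \<Theta> \<Longrightarrow> noise_var \<eta> x \<noteq> 0"
  using noise_var_pos[of \<eta> x] by simp

lemma H_nth: "H \<eta> k $ i = feature \<eta> (Xs k $ i)"
  unfolding H_def by (rule Kmat_KRR_inv_nth)

lemma V_eq: "V \<eta> k = (\<chi> i j. if i = j then noise_var \<eta> (Xs k $ i) else 0)"
  by (simp add: V_def diag_part_def mat_def vec_eq_iff Dmat_diag noise_var_def)

lemma V_pos_def: "\<eta> \<in> \<Theta> \<Longrightarrow> pos_def (V \<eta> k)"
  unfolding V_eq by (intro pos_def_diag_matrix noise_var_pos)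

lemma V_inv:
  assumes "\<eta> \<in> \<Theta>"
  shows "matrix_inv (V \<eta> k) = (\<chi> i j. if i = j then 1 / noise_var \<eta> (Xs k $ i) else 0)"
  unfolding V_eq by (rule matrix_inv_diag_matrix) (rule noise_var_nonzero[OF assms])

lemma ln_det_V:
  assumes "\<eta> \<in> \<Theta>" shows "ln (det (V \<eta> k)) = (\<Sum>i\<in>UNIV. ln (noise_var \<eta> (Xs k $ i)))"
  unfolding V_eq det_diag_matrix
  by (rule ln_prod) (simp_all add: noise_var_nonzero[OF assms])

lemma batch_info:
  assumes "\<eta> \<in> \<Theta>"
  shows "transpose (H \<eta> k) ** matrix_inv (V \<eta> k) ** H \<eta> k = (\<Sum>b\<in>UNIV. datum_info \<eta> (Xs k $ b))"
  by (simp add: V_inv[OF assms] matrix_mult_diag_matrix)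
     (simp add: vec_eq_iff matrix_matrix_mult_def transpose_def H_nth datum_info_def)

lemma batch_score:
  assumes "\<eta> \<in> \<Theta>"
  shows "(transpose (H \<eta> k) ** matrix_inv (V \<eta> k)) *v ys k = (\<Sum>b\<in>UNIV. datum_score \<eta> (Xs k $ b) (ys k $ b))"
  by (simp add: V_inv[OF assms] matrix_mult_diag_matrix)
     (simp add: vec_eq_iff matrix_vector_mult_def transpose_def H_nth datum_score_def)

lemma batch_quadratic_form:
  assumes "\<eta> \<in> \<Theta>"
  shows "ys k \<bullet> (matrix_inv (V \<eta> k) *v ys k) = (\<Sum>b\<in>UNIV. (ys k $ b)\<^sup>2 / noise_var \<eta> (Xs k $ b))"
  by (simp add: V_inv[OF assms] diag_matrix_mult_vec inner_vec_def power2_eq_square)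

text \<open>Closed forms for the posterior precision and the information vector after
  \<open>k\<close> batches. At \<open>k = 0\<close> the sums are empty and the prior
  remains.\<close>

definition info :: "('p, 'd, 'm) params \<Rightarrow> nat \<Rightarrow> real^'m^'m" where
  "info \<eta> k = matrix_inv (KRR \<eta>) + (\<Sum>j=1..k. \<Sum>b\<in>UNIV. datum_info \<eta> (Xs j $ b))"

definition score :: "('p, 'd, 'm) params \<Rightarrow> nat \<Rightarrow> real^'m" where
  "score \<eta> k = (\<Sum>j=1..k. \<Sum>b\<in>UNIV. datum_score \<eta> (Xs j $ b) (ys j $ b))"

declare r.simps [simp del] S.simps [simp del] G.simps [simp del]

text \<open>Each step is one \<open>kalman_update\<close>: Woodbury adds the batch's precision and
  the mean formula adds its score. Positive definiteness is part of the induction because the next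
  update presupposes it.\<close>

lemma information_filter:
  assumes \<eta>: "\<eta> \<in> \<Theta>"
  shows "pos_def (\<Sigma> \<eta> k) \<and> matrix_inv (\<Sigma> \<eta> k) = info \<eta> k \<and> info \<eta> k *v \<mu> \<eta> k = score \<eta> k"
proof (induction k)
  case 0
  show ?case by (simp add: KRR_pos_def \<eta> info_def score_def)
next
  case (Suc k)
  interpret kalman_update "H \<eta> (Suc k)" "\<Sigma> \<eta> k" "V \<eta> (Suc k)"
    by unfold_locales (use Suc V_pos_def \<eta> in auto)
  have S: "S \<eta> (Suc k) = innovation" by (simp add: S.simps innovation_def)
  have G: "G \<eta> (Suc k) = gain" by (simp add: G.simps gain_def S)
  have inf: "information = info \<eta> (Suc k)"
    using Suc unfolding information_def batch_info[OF \<eta>] by (simp add: info_def)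
  have "\<Sigma> \<eta> (Suc k) = matrix_inv information"
    unfolding \<Sigma>.simps S G by (rule posterior_cov)
  then have "pos_def (\<Sigma> \<eta> (Suc k))" "matrix_inv (\<Sigma> \<eta> (Suc k)) = info \<eta> (Suc k)"
    by (simp_all add: pos_def_matrix_inv information_pos_def matrix_inv_matrix_inv pos_def_invertible inf[symmetric])
  moreover have "info \<eta> (Suc k) *v \<mu> \<eta> (Suc k) = score \<eta> (Suc k)"
    using posterior_mean[of "\<mu> \<eta> k" "ys (Suc k)"] Suc
    unfolding batch_score[OF \<eta>] by (simp add: inf G r.simps score_def)
  ultimately show ?case by simp
qed

text \<open>The indices are independent so that \<open>k - 1\<close> can be paired with
  \<open>k\<close> even at \<open>k = 0\<close>, where subtraction truncates.\<close>

lemma kalman_update: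
  assumes "\<eta> \<in> \<Theta>" shows "kalman_update (\<Sigma> \<eta> k) (V \<eta> j)"
  by (rule kalman_update.intro) (simp_all add: information_filter V_pos_def assms)

lemma S_pos_def:
  assumes "\<eta> \<in> \<Theta>" shows "pos_def (S \<eta> k)"
proof -
  interpret kalman_update "H \<eta> k" "\<Sigma> \<eta> (k - 1)" "V \<eta> k"
    by (rule kalman_update[OF assms])
  show ?thesis using innovation_pos_def unfolding S.simps innovation_def .
qed

lemma d_eq:
  assumes "\<eta> \<in> \<Theta>"
  shows "d \<eta> k = - (1/2) * (CARD('b) * ln (2 * pi) + ln (det (S \<eta> k)) + r \<eta> k \<bullet> (matrix_inv (S \<eta> k) *v r \<eta> k))"
  unfolding d_def using ln_gauss_density[OF pos_def_det_pos[OF S_pos_def[OF assms]], of "r \<eta> k" 0 k] by simp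

text \<open>The log-determinant of \<open>info\<close> and the form of \<open>info\<close> at the
  mean act as potentials whose increments appear in each step. The term for \<open>KRR\<close> is
  the boundary value, since \<open>info\<close> starts at its inverse; the quadratic potential
  starts at zero with the mean.\<close>

lemma sum_log_likelihood_telescopes:
  assumes \<eta>: "\<eta> \<in> \<Theta>"
  shows "(\<Sum>k=1..K. ln (det (S \<eta> k)) + r \<eta> k \<bullet> (matrix_inv (S \<eta> k) *v r \<eta> k)) =
    (\<Sum>k=1..K. ln (det (V \<eta> k)) + ys k \<bullet> (matrix_inv (V \<eta> k) *v ys k))
    + ln (det (info \<eta> K)) + ln (det (KRR \<eta>)) - \<mu> \<eta> K \<bullet> (info \<eta> K *v \<mu> \<eta> K)"
proof (induction K)
  case 0
  show ?case using ln_det_matrix_inv[OF KRR_pos_def[OF \<eta>]] by (simp add: info_def)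
next
  case (Suc k)
  interpret kalman_update "H \<eta> (Suc k)" "\<Sigma> \<eta> k" "V \<eta> (Suc k)"
    by (rule kalman_update[OF \<eta>])
  note IF = information_filter[OF \<eta>, of k, THEN conjunct2, THEN conjunct1]
    information_filter[OF \<eta>, of "Suc k", THEN conjunct2, THEN conjunct1]
  have S: "S \<eta> (Suc k) = innovation" by (simp add: S.simps innovation_def)
  have G: "G \<eta> (Suc k) = gain" by (simp add: G.simps gain_def S)
  have inf: "information = info \<eta> (Suc k)"
    unfolding information_def batch_info[OF \<eta>] by (simp add: IF info_def)
  have "ln (det (S \<eta> (Suc k))) = ln (det (V \<eta> (Suc k))) + ln (det (info \<eta> (Suc k))) - ln (det (info \<eta> k))"
    using ln_det_innovation ln_det_matrix_inv[OF P] by (simp add: S inf IF)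
  moreover have "r \<eta> (Suc k) \<bullet> (matrix_inv (S \<eta> (Suc k)) *v r \<eta> (Suc k)) =
      ys (Suc k) \<bullet> (matrix_inv (V \<eta> (Suc k)) *v ys (Suc k)) + \<mu> \<eta> k \<bullet> (info \<eta> k *v \<mu> \<eta> k)
      - \<mu> \<eta> (Suc k) \<bullet> (info \<eta> (Suc k) *v \<mu> \<eta> (Suc k))"
    using innovation_quadratic_form[of "\<mu> \<eta> (Suc k)" "\<mu> \<eta> k" "ys (Suc k)"]
    by (simp add: S G inf r.simps IF)
  ultimately show ?case using Suc by simp
qed

lemma \<psi>_total_eq_information_bound:
  assumes \<eta>: "\<eta> \<in> \<Theta>"
  shows "\<psi>_total K \<eta> = information_bound \<eta>
    (\<Sum>k=1..K. \<Sum>b\<in>UNIV. datum_cost \<eta> (Xs k $ b) (ys k $ b))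
    (\<Sum>k=1..K. \<Sum>b\<in>UNIV. datum_info \<eta> (Xs k $ b))
    (\<Sum>k=1..K. \<Sum>b\<in>UNIV. datum_score \<eta> (Xs k $ b) (ys k $ b))"
proof -
  note IF = information_filter[OF \<eta>, of K]
  have "\<psi>_total K \<eta> = - (1/2) * ((\<Sum>k=1..K. CARD('b) * ln (2 * pi)) +
      (\<Sum>k=1..K. ln (det (S \<eta> k)) + r \<eta> k \<bullet> (matrix_inv (S \<eta> k) *v r \<eta> k)) + (\<Sum>k=1..K. 2 * a \<eta> k))"
    unfolding \<psi>_total_def \<psi>_def d_eq[OF \<eta>] sum_distrib_left sum.distrib[symmetric]
    by (intro sum.cong refl) (simp add: algebra_simps)
  also have "(\<Sum>k=1..K. CARD('b) * ln (2 * pi)) +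
      (\<Sum>k=1..K. ln (det (S \<eta> k)) + r \<eta> k \<bullet> (matrix_inv (S \<eta> k) *v r \<eta> k)) + (\<Sum>k=1..K. 2 * a \<eta> k) =
      (\<Sum>k=1..K. CARD('b) * ln (2 * pi) + (ln (det (V \<eta> k)) + ys k \<bullet> (matrix_inv (V \<eta> k) *v ys k)) + 2 * a \<eta> k)
      + ln (det (info \<eta> K)) + ln (det (KRR \<eta>)) - \<mu> \<eta> K \<bullet> (info \<eta> K *v \<mu> \<eta> K)"
    unfolding sum_log_likelihood_telescopes[OF \<eta>] by (simp only: sum.distrib)
  also have "(\<Sum>k=1..K. CARD('b) * ln (2 * pi) + (ln (det (V \<eta> k)) + ys k \<bullet> (matrix_inv (V \<eta> k) *v ys k)) + 2 * a \<eta> k)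
     = (\<Sum>k=1..K. \<Sum>b\<in>UNIV. datum_cost \<eta> (Xs k $ b) (ys k $ b))"
    by (intro sum.cong refl)
       (simp add: ln_det_V[OF \<eta>] batch_quadratic_form[OF \<eta>] a_def Dmat_diag datum_cost_def sum.distrib sum_distrib_left)
  \<comment> \<open>Solving \<open>info *v \<mu> = score\<close> for the mean leaves only sums over
    observations.\<close>
  also have "\<mu> \<eta> K \<bullet> (info \<eta> K *v \<mu> \<eta> K) = score \<eta> K \<bullet> (matrix_inv (info \<eta> K) *v score \<eta> K)"
  proof -
    have "invertible (info \<eta> K)"
      using IF pos_def_matrix_inv pos_def_invertible by metis
    moreover have "info \<eta> K *v \<mu> \<eta> K = score \<eta> K" using IF by blast
    ultimately have "matrix_inv (info \<eta> K) *v score \<eta> K = \<mu> \<eta> K"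
      by (metis matrix_inv_left matrix_vector_mul_assoc matrix_vector_mul_lid)
    then show ?thesis using IF by (simp add: inner_commute)
  qed
  finally show ?thesis by (simp add: information_bound_def info_def score_def)
qed

end

text \<open>A single batch holding all data, with prior mean zero, has the targets as residual. Its
  predictive covariance is the batch covariance.\<close>

lemma L_PEP_eq_\<psi>_total:
  fixes \<Theta> :: "('p::finite, 'd::finite, 'm::finite) params set" and X :: "real^'d^'n::finite"
  assumes "pep_regular \<kappa> \<alpha> \<Theta>" and \<eta>: "\<eta> \<in> \<Theta>"
  shows "sparse_gp.L_PEP \<kappa> \<alpha> X y \<eta> = pep_recursion.\<psi>_total \<kappa> \<alpha> (\<lambda>_. X) (\<lambda>_. y) 1 \<eta>"
proof -
  interpret pep_regular \<kappa> \<alpha> "\<lambda>_. X" "\<lambda>_. y" \<Theta> by fact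
  have sym: "transpose (matrix_inv (KRR \<eta>)) = matrix_inv (KRR \<eta>)"
    using pos_def_matrix_inv[OF KRR_pos_def[OF \<eta>]] by (simp add: pos_def_def)
  have Kt: "transpose (Kmat \<eta> X (inducing \<eta>)) = Kmat \<eta> (inducing \<eta>) X"
    by (simp add: Kmat_def transpose_def vec_eq_iff kernel_sym[OF \<eta>])
  \<comment> \<open>The inner factor \<open>matrix_inv (KRR \<eta>) ** KRR \<eta>\<close> collapses,
    leaving \<open>Qmat \<eta> X X\<close>.\<close>
  have "H \<eta> 1 ** KRR \<eta> ** transpose (H \<eta> 1) =
     Kmat \<eta> X (inducing \<eta>) ** (matrix_inv (KRR \<eta>) ** KRR \<eta>) ** matrix_inv (KRR \<eta>) ** Kmat \<eta> (inducing \<eta>) X"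
    by (simp only: H_def matrix_transpose_mul sym Kt matrix_mul_assoc)
  then have "S \<eta> 1 = Qmat \<eta> X X + V \<eta> 1"
    by (simp add: S.simps Qmat_def matrix_inv_left KRR_invertible \<eta>)
  then show ?thesis
    by (simp add: L_PEP_def \<psi>_total_def \<psi>_def d_def a_def r.simps V_def add.assoc)
qed

text \<open>Both bounds are \<open>information_bound\<close> of sums over observations, and
  regrouping turns each mini-batch sum into the full one.\<close>

lemma L_PEP_eq_recursive_bound:
  fixes \<Theta> :: "('p::finite, 'd::finite, 'm::finite) params set"
    and X :: "real^'d^'n::{finite,linorder}" and Xs :: "nat \<Rightarrow> real^'d^'b::{finite,linorder}"
  assumes "pep_regular \<kappa> \<alpha> \<Theta>" and \<eta>: "\<eta> \<in> \<Theta>"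
    and card: "CARD('n) = K * CARD('b)"
    and Xs: "\<And>k. k \<in> {1..K} \<Longrightarrow> Xs k = mini_batch X k"
    and ys: "\<And>k. k \<in> {1..K} \<Longrightarrow> ys k = mini_batch y k"
  shows "sparse_gp.L_PEP \<kappa> \<alpha> X y \<eta> = pep_recursion.\<psi>_total \<kappa> \<alpha> Xs ys K \<eta>"
proof -
  interpret batch: pep_regular \<kappa> \<alpha> "\<lambda>_. X" "\<lambda>_. y" \<Theta> by fact
  interpret pep_regular \<kappa> \<alpha> Xs ys \<Theta> by fact
  have regroup: "(\<Sum>k=1..K. \<Sum>b\<in>UNIV. f (Xs k $ b) (ys k $ b)) = (\<Sum>n\<in>UNIV. f (X $ n) (y $ n))"
    for f :: "real^'d \<Rightarrow> real \<Rightarrow> 'z::comm_monoid_add"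
    using sum_mini_batch[OF card, of f X y] by (simp add: Xs ys)
  show ?thesis
    unfolding L_PEP_eq_\<psi>_total[OF assms(1) \<eta>] \<psi>_total_eq_information_bound[OF \<eta>]
      batch.\<psi>_total_eq_information_bound[OF \<eta>]
    using regroup[of "batch.datum_cost \<eta>"] regroup[of "\<lambda>x _. batch.datum_info \<eta> x"]
      regroup[of "batch.datum_score \<eta>"]
    by simp
qed

section \<open>Gradient propagation\<close>

text \<open>\<open>vector_derivative\<close> is defined by choice, so a dotted quantity is a genuine
  derivative only once differentiability has been shown.\<close>

lemma partial_deriv_works:
  assumes "(\<lambda>t. f (\<theta> + t *\<^sub>R e)) differentiable (at 0)"
  shows "((\<lambda>t. f (\<theta> + t *\<^sub>R e)) has_vector_derivative partial_deriv e f \<theta>) (at 0)"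
  using assms unfolding partial_deriv_def by (simp add: vector_derivative_works)

section \<open>Differentiability of the quantities given explicitly by the kernel and the
  noise\<close>

lemma differentiable_matrixI:
  fixes A :: "real \<Rightarrow> real^'n^'m"
  assumes "\<And>i j. (\<lambda>t. A t $ i $ j) differentiable (at t)"
  shows "A differentiable (at t)"
proof -
  have "(A has_vector_derivative (\<chi> i j. deriv (\<lambda>t. A t $ i $ j) t)) (at t)"
    using assms by (intro has_vector_derivative_matrixI) (simp add: DERIV_deriv_iff_real_differentiable)
  then show ?thesis by (rule differentiableI_vector)
qed

lemma differentiable_matrix_nth:
  fixes A :: "real \<Rightarrow> real^'n^'m"
  assumes "A differentiable (at t)"
  shows "(\<lambda>t. A t $ i $ j) differentiable (at t)"
  using has_real_derivative_matrix_nth[OF assms[THEN vector_derivative_works[THEN iffD1]]]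
  by (auto simp: real_differentiable_def)

lemma differentiable_matrix_mult:
  fixes A :: "real \<Rightarrow> real^'n^'m" and B :: "real \<Rightarrow> real^'k^'n"
  assumes "A differentiable (at t)" "B differentiable (at t)"
  shows "(\<lambda>t. A t ** B t) differentiable (at t)"
  using assms[THEN vector_derivative_works[THEN iffD1]]
  by (blast intro: differentiableI_vector has_vector_derivative_matrix_matrix_mult)

lemma differentiable_matrix_inv:
  fixes A :: "real \<Rightarrow> real^'n^'n"
  assumes "A differentiable (at t)" "invertible (A t)"
  shows "(\<lambda>t. matrix_inv (A t)) differentiable (at t)"
  using assms(1)[THEN vector_derivative_works[THEN iffD1]] assms(2)
  by (blast intro: differentiableI_vector has_vector_derivative_matrix_inv)

lemma has_vector_derivative_transpose:
  fixes A :: "real \<Rightarrow> real^'n^'m"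
  shows "(A has_vector_derivative A') F \<Longrightarrow> ((\<lambda>t. transpose (A t)) has_vector_derivative transpose A') F"
  by (rule bounded_linear.has_vector_derivative[OF bounded_linear_transpose])

context pep_regular
begin

lemma eventually_in_\<Theta>:
  assumes "\<theta> \<in> \<Theta>" shows "\<forall>\<^sub>F t in nhds 0. \<theta> + t *\<^sub>R e \<in> \<Theta>"
proof -
  have "((\<lambda>t. \<theta> + t *\<^sub>R e) \<longlongrightarrow> \<theta> + 0 *\<^sub>R e) (nhds 0)"
    by (intro tendsto_intros filterlim_ident)
  then show ?thesis
    using open_\<Theta> assms by (auto dest: topological_tendstoD)
qed

text \<open>Chain rule with the jointly differentiable kernel. Both arguments are curves, which
  covers the fixed data as well as the inducing inputs that move with the parameter.\<close>

lemma Kmat_differentiable: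
  fixes A :: "real \<Rightarrow> real^'d^'i" and B :: "real \<Rightarrow> real^'d^'j"
  assumes \<theta>: "\<theta> \<in> \<Theta>" and A: "A differentiable (at 0)" and B: "B differentiable (at 0)"
  shows "(\<lambda>t. Kmat (\<theta> + t *\<^sub>R e) (A t) (B t)) differentiable (at 0)"
proof (rule differentiable_matrixI)
  fix i j
  have row: "(\<lambda>t. C t $ l) differentiable (at 0)" if "C differentiable (at 0)"
    for C :: "real \<Rightarrow> real^'d^'k" and l
    using has_vector_derivative_vec_nth[OF that[THEN vector_derivative_works[THEN iffD1]]]
    by (rule differentiableI_vector)
  have "(\<lambda>t. (hyper \<theta> + t *\<^sub>R hyper e, A t $ i, B t $ j)) differentiable (at 0)"
    by (intro differentiable_Pair row A B) (auto intro!: derivative_intros)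
  moreover have "(\<lambda>(h, u, v). \<kappa> h u v) differentiable
      (at (hyper \<theta> + 0 *\<^sub>R hyper e, A 0 $ i, B 0 $ j))"
    using kernel_differentiable[OF \<theta>] by simp
  ultimately have "((\<lambda>(h, u, v). \<kappa> h u v) \<circ> (\<lambda>t. (hyper \<theta> + t *\<^sub>R hyper e, A t $ i, B t $ j)))
      differentiable (at 0)"
    by (rule differentiable_chain_at)
  then show "(\<lambda>t. Kmat (\<theta> + t *\<^sub>R e) (A t) (B t) $ i $ j) differentiable (at 0)"
    by (simp add: Kmat_def o_def)
qed

lemma inducing_differentiable: "(\<lambda>t. inducing (\<theta> + t *\<^sub>R e)) differentiable (at 0)"
  by (auto intro!: derivative_intros)

lemma KRR_differentiable: "\<theta> \<in> \<Theta> \<Longrightarrow> (\<lambda>t. KRR (\<theta> + t *\<^sub>R e)) differentiable (at 0)"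
  unfolding KRR_def by (intro Kmat_differentiable inducing_differentiable)

lemma KRR_inv_differentiable: "\<theta> \<in> \<Theta> \<Longrightarrow> (\<lambda>t. matrix_inv (KRR (\<theta> + t *\<^sub>R e))) differentiable (at 0)"
  by (intro differentiable_matrix_inv KRR_differentiable) (simp_all add: KRR_invertible)

lemma H_differentiable: "\<theta> \<in> \<Theta> \<Longrightarrow> (\<lambda>t. H (\<theta> + t *\<^sub>R e) k) differentiable (at 0)"
  unfolding H_def
  by (intro differentiable_matrix_mult Kmat_differentiable KRR_inv_differentiable inducing_differentiable) auto

lemma Dmat_differentiable: "\<theta> \<in> \<Theta> \<Longrightarrow> (\<lambda>t. Dmat (\<theta> + t *\<^sub>R e) X) differentiable (at 0)"
  for X :: "real^'d^'i"
  unfolding Dmat_def Qmat_def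
  by (intro differentiable_diff differentiable_matrix_mult Kmat_differentiable KRR_inv_differentiable
      inducing_differentiable) auto

lemma noise_differentiable: "(\<lambda>t. (noise (\<theta> + t *\<^sub>R e))\<^sup>2) differentiable (at 0)"
  by (auto intro!: derivative_intros)

lemma V_differentiable:
  assumes "\<theta> \<in> \<Theta>" shows "(\<lambda>t. V (\<theta> + t *\<^sub>R e) k) differentiable (at 0)"
proof (rule differentiable_matrixI)
  fix i j
  have "(\<lambda>t. \<alpha> * Dmat (\<theta> + t *\<^sub>R e) (Xs k) $ i $ i + (noise (\<theta> + t *\<^sub>R e))\<^sup>2) differentiable (at 0)"
    by (intro differentiable_add differentiable_mult differentiable_const noise_differentiable
        differentiable_matrix_nth Dmat_differentiable assms)
  then show "(\<lambda>t. V (\<theta> + t *\<^sub>R e) k $ i $ j) differentiable (at 0)"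
    by (cases "i = j") (simp_all add: V_def diag_part_def mat_def)
qed

lemma a_differentiable:
  assumes \<theta>: "\<theta> \<in> \<Theta>" shows "(\<lambda>t. a (\<theta> + t *\<^sub>R e) k) differentiable (at 0)"
proof -
  let ?u = "\<lambda>i t. 1 + \<alpha> / (noise (\<theta> + t *\<^sub>R e))\<^sup>2 * Dmat (\<theta> + t *\<^sub>R e) (Xs k) $ i $ i"
  have ln: "(\<lambda>t. ln (?u i t)) differentiable (at 0)" for i
  proof -
    have "?u i differentiable (at 0)"
      using noise_pos[OF \<theta>]
      by (intro differentiable_add differentiable_mult differentiable_divide differentiable_const
          noise_differentiable differentiable_matrix_nth Dmat_differentiable \<theta>) simp
    then have u: "(?u i has_real_derivative deriv (?u i) 0) (at 0)"
      by (simp add: DERIV_deriv_iff_real_differentiable)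
    \<comment> \<open>Nonnegative residual variance keeps the argument of the logarithm at least
      1.\<close>
    have pos: "0 < ?u i 0"
      using resid_var_nonneg[OF \<theta>] \<alpha>_pos by (simp add: Dmat_diag add_pos_nonneg)
    show ?thesis
      using DERIV_chain2[OF DERIV_ln_divide[OF pos] u] unfolding real_differentiable_def by blast
  qed
  show ?thesis
    unfolding a_def by (intro differentiable_mult differentiable_const differentiable_sum ballI ln) simp
qed

lemmas KRR_dot_works = partial_deriv_works[OF KRR_differentiable, folded KRR_dot_def]
lemmas H_dot_works = partial_deriv_works[of "\<lambda>\<theta>. H \<theta> k" for k, OF H_differentiable, folded H_dot_def]
lemmas V_dot_works = partial_deriv_works[of "\<lambda>\<theta>. V \<theta> k" for k, OF V_differentiable, folded V_dot_def]
lemmas a_dot_works = partial_deriv_works[of "\<lambda>\<theta>. a \<theta> k" for k, OF a_differentiable, folded a_dot_def]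

section \<open>Correctness of the propagated derivatives\<close>

declare r_dot.simps [simp del] S_dot.simps [simp del] G_dot.simps [simp del]

text \<open>Product rule and derivative of the inverse. The step is conditional on the derivatives
  at the preceding index, so it can be used inside the induction for \<open>\<mu>\<close> and
  \<open>\<Sigma>\<close> and again after it.\<close>

lemma r_S_G_dot_works:
  assumes \<theta>: "\<theta> \<in> \<Theta>"
    and \<mu>: "((\<lambda>t. \<mu> (\<theta> + t *\<^sub>R e) (k - 1)) has_vector_derivative \<mu>_dot e \<theta> (k - 1)) (at 0)"
    and \<Sigma>: "((\<lambda>t. \<Sigma> (\<theta> + t *\<^sub>R e) (k - 1)) has_vector_derivative \<Sigma>_dot e \<theta> (k - 1)) (at 0)"
  shows r_dot_works: "((\<lambda>t. r (\<theta> + t *\<^sub>R e) k) has_vector_derivative r_dot e \<theta> k) (at 0)"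
    and S_dot_works: "((\<lambda>t. S (\<theta> + t *\<^sub>R e) k) has_vector_derivative S_dot e \<theta> k) (at 0)"
    and G_dot_works: "((\<lambda>t. G (\<theta> + t *\<^sub>R e) k) has_vector_derivative G_dot e \<theta> k) (at 0)"
proof -
  note H = H_dot_works[OF \<theta>, of e k] and V = V_dot_works[OF \<theta>, of e k]
  note mm = has_vector_derivative_matrix_matrix_mult and mv = has_vector_derivative_matrix_vector_mult
    and tr = has_vector_derivative_transpose
  show "((\<lambda>t. r (\<theta> + t *\<^sub>R e) k) has_vector_derivative r_dot e \<theta> k) (at 0)"
    using has_vector_derivative_diff[OF has_vector_derivative_const[of "ys k"] mv[OF H \<mu>]]
    by (simp add: r.simps r_dot.simps minus_diff_commute)
  show S: "((\<lambda>t. S (\<theta> + t *\<^sub>R e) k) has_vector_derivative S_dot e \<theta> k) (at 0)"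
    using has_vector_derivative_add[OF mm[OF mm[OF H \<Sigma>] tr[OF H]] V]
    by (simp add: S.simps S_dot.simps matrix_add_rdistrib_real algebra_simps)
  have "((\<lambda>t. matrix_inv (S (\<theta> + t *\<^sub>R e) k)) has_vector_derivative
      - (matrix_inv (S \<theta> k) ** S_dot e \<theta> k ** matrix_inv (S \<theta> k))) (at 0)"
    using has_vector_derivative_matrix_inv[OF S] pos_def_invertible[OF S_pos_def[OF \<theta>]] by simp
  from mm[OF mm[OF \<Sigma> tr[OF H]] this]
  show "((\<lambda>t. G (\<theta> + t *\<^sub>R e) k) has_vector_derivative G_dot e \<theta> k) (at 0)"
    by (simp add: G.simps G_dot.simps matrix_add_rdistrib_real matrix_mul_assoc
        bounded_bilinear.minus_right[OF bounded_bilinear_matrix_matrix_mult] algebra_simps)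
qed

lemma \<mu>_\<Sigma>_dot_works:
  assumes \<theta>: "\<theta> \<in> \<Theta>"
  shows "((\<lambda>t. \<mu> (\<theta> + t *\<^sub>R e) k) has_vector_derivative \<mu>_dot e \<theta> k) (at 0) \<and>
    ((\<lambda>t. \<Sigma> (\<theta> + t *\<^sub>R e) k) has_vector_derivative \<Sigma>_dot e \<theta> k) (at 0)"
proof (induction k)
  case 0
  show ?case using KRR_dot_works[OF \<theta>] by simp
next
  case (Suc k)
  note mm = has_vector_derivative_matrix_matrix_mult and mv = has_vector_derivative_matrix_vector_mult
    and tr = has_vector_derivative_transpose
  from Suc have IH: "((\<lambda>t. \<mu> (\<theta> + t *\<^sub>R e) k) has_vector_derivative \<mu>_dot e \<theta> k) (at 0)"
    "((\<lambda>t. \<Sigma> (\<theta> + t *\<^sub>R e) k) has_vector_derivative \<Sigma>_dot e \<theta> k) (at 0)" by auto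
  have rSG: "((\<lambda>t. r (\<theta> + t *\<^sub>R e) (Suc k)) has_vector_derivative r_dot e \<theta> (Suc k)) (at 0)"
    "((\<lambda>t. S (\<theta> + t *\<^sub>R e) (Suc k)) has_vector_derivative S_dot e \<theta> (Suc k)) (at 0)"
    "((\<lambda>t. G (\<theta> + t *\<^sub>R e) (Suc k)) has_vector_derivative G_dot e \<theta> (Suc k)) (at 0)"
    by (rule r_S_G_dot_works[OF \<theta>]; simp add: IH)+
  have "((\<lambda>t. \<mu> (\<theta> + t *\<^sub>R e) (Suc k)) has_vector_derivative \<mu>_dot e \<theta> (Suc k)) (at 0)"
    using has_vector_derivative_add[OF IH(1) mv[OF rSG(3) rSG(1)]] by (simp add: algebra_simps)
  moreover have "((\<lambda>t. \<Sigma> (\<theta> + t *\<^sub>R e) (Suc k)) has_vector_derivative \<Sigma>_dot e \<theta> (Suc k)) (at 0)"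
    using has_vector_derivative_diff[OF IH(2) mm[OF mm[OF rSG(3) rSG(2)] tr[OF rSG(3)]]]
    by (simp add: matrix_add_rdistrib_real algebra_simps)
  ultimately show ?case by blast
qed

lemma d_dot_works:
  assumes \<theta>: "\<theta> \<in> \<Theta>"
  shows "((\<lambda>t. d (\<theta> + t *\<^sub>R e) k) has_real_derivative d_dot e \<theta> k) (at 0)"
proof -
  let ?\<gamma> = "\<lambda>t. \<theta> + t *\<^sub>R e" and ?Si = "matrix_inv (S \<theta> k)"
  note rec = \<mu>_\<Sigma>_dot_works[OF \<theta>, of e "k - 1", THEN conjunct1] \<mu>_\<Sigma>_dot_works[OF \<theta>, of e "k - 1", THEN conjunct2]
  note r = r_dot_works[OF \<theta> rec] and S = S_dot_works[OF \<theta> rec]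
  note inv = pos_def_invertible[OF S_pos_def[OF \<theta>]]
  have sym: "transpose ?Si = ?Si"
    using pos_def_matrix_inv[OF S_pos_def[OF \<theta>]] by (simp add: pos_def_def)
  have ln_det: "((\<lambda>t. ln (det (S (?\<gamma> t) k))) has_real_derivative trace (?Si ** S_dot e \<theta> k)) (at 0)"
    using pos_def_det_pos[OF S_pos_def[OF \<theta>], of k]
    by (auto intro!: derivative_eq_intros has_real_derivative_det[OF S] inv)
  have quad: "((\<lambda>t. r (?\<gamma> t) k \<bullet> (matrix_inv (S (?\<gamma> t) k) *v r (?\<gamma> t) k)) has_real_derivative
      2 * (r \<theta> k \<bullet> (?Si *v r_dot e \<theta> k)) - r \<theta> k \<bullet> ((?Si ** S_dot e \<theta> k ** ?Si) *v r \<theta> k)) (at 0)"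
  proof -
    have "((\<lambda>t. matrix_inv (S (?\<gamma> t) k)) has_vector_derivative - (?Si ** S_dot e \<theta> k ** ?Si)) (at 0)"
      using has_vector_derivative_matrix_inv[OF S] inv by simp
    from bounded_bilinear.has_vector_derivative[OF bounded_bilinear_inner r
        has_vector_derivative_matrix_vector_mult[OF this r]]
    have "((\<lambda>t. r (?\<gamma> t) k \<bullet> (matrix_inv (S (?\<gamma> t) k) *v r (?\<gamma> t) k)) has_real_derivative
        r \<theta> k \<bullet> (?Si *v r_dot e \<theta> k + (- (?Si ** S_dot e \<theta> k ** ?Si)) *v r \<theta> k)
        + r_dot e \<theta> k \<bullet> (?Si *v r \<theta> k)) (at 0)"
      by (simp add: has_real_derivative_iff_has_vector_derivative)
    \<comment> \<open>Symmetry of the inverse makes the two residual terms equal; the resulting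
      factor 2 cancels against 1/2 in \<open>d_dot\<close>.\<close>
    moreover have "r_dot e \<theta> k \<bullet> (?Si *v r \<theta> k) = r \<theta> k \<bullet> (?Si *v r_dot e \<theta> k)"
      using inner_matrix_vector_mult[of "r_dot e \<theta> k" ?Si "r \<theta> k"] by (simp only: sym inner_commute)
    ultimately show ?thesis
      by (simp add: inner_add_right inner_diff_right bounded_bilinear.minus_left[OF bounded_bilinear_matrix_vector_mult])
  qed
  have "((\<lambda>t. - (1/2) * (CARD('b) * ln (2 * pi) + ln (det (S (?\<gamma> t) k))
      + r (?\<gamma> t) k \<bullet> (matrix_inv (S (?\<gamma> t) k) *v r (?\<gamma> t) k))) has_real_derivative d_dot e \<theta> k) (at 0)"
    by (rule DERIV_cong[OF DERIV_cmult[OF DERIV_add[OF DERIV_add[OF DERIV_const ln_det] quad]]])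
       (simp add: d_dot_def field_simps)
  \<comment> \<open>The expanded form of \<open>d\<close> is available only on
    \<open>\<Theta>\<close>, which the line through \<open>\<theta>\<close> stays in near 0.\<close>
  then show ?thesis
    unfolding has_real_derivative_iff_has_vector_derivative
    by (rule has_vector_derivative_transform_at_eventually)
       (rule eventually_mono[OF eventually_in_\<Theta>[OF \<theta>, of e]], rule d_eq[symmetric])
qed

lemma \<psi>_total_has_derivative:
  assumes \<theta>: "\<theta> \<in> \<Theta>"
  shows "((\<lambda>t. \<psi>_total K (\<theta> + t *\<^sub>R e)) has_real_derivative (\<Sum>k=1..K. \<psi>_dot e \<theta> k)) (at 0)"
  unfolding \<psi>_total_def \<psi>_def \<psi>_dot_def
  using a_dot_works[OF \<theta>] unfolding has_real_derivative_iff_has_vector_derivative[symmetric]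
  by (intro DERIV_sum DERIV_diff d_dot_works \<theta>)

end

text \<open>Partial derivatives are expressed along the lines
  \<open>\<theta> + t *\<^sub>R e\<close>, so the existence of the derivative is asserted together
  with its value.\<close>

theorem proposition1:
  fixes \<kappa> :: "('p::finite, 'd::finite) kernel"
    and \<alpha> :: real
    and X :: "real^'d^'n::{finite,linorder}"
    and y :: "real^'n::{finite,linorder}"
    and K :: nat
    and Xs :: "nat \<Rightarrow> real^'d^'b::{finite,linorder}"
    and ys :: "nat \<Rightarrow> real^'b::{finite,linorder}"
    and \<Theta> :: "('p, 'd, 'm::finite) params set"
    and \<theta> :: "('p, 'd, 'm) params"
  assumes "\<alpha> > 0"
    and "CARD('n) = K * CARD('b)"
    and "\<And>k. k \<in> {1..K} \<Longrightarrow> Xs k = mini_batch X k"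
    and "\<And>k. k \<in> {1..K} \<Longrightarrow> ys k = mini_batch y k"
    and "open \<Theta>"
    and "\<And>\<eta>. \<eta> \<in> \<Theta> \<Longrightarrow> noise \<eta> > 0"
    and "\<And>\<eta>. \<eta> \<in> \<Theta> \<Longrightarrow> pos_def_kernel (\<kappa> (hyper \<eta>))"
    and "\<And>\<eta> x x'. \<eta> \<in> \<Theta> \<Longrightarrow>
           (\<lambda>(h, u, v). \<kappa> h u v) differentiable (at (hyper \<eta>, x, x'))"
    and "\<And>\<eta>. \<eta> \<in> \<Theta> \<Longrightarrow> invertible (sparse_gp.KRR \<kappa> \<eta>)"
    and "\<theta> \<in> \<Theta>"
  shows "\<forall>e\<in>Basis.
      ((\<lambda>t. sparse_gp.L_PEP \<kappa> \<alpha> X y (\<theta> + t *\<^sub>R e))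
         has_real_derivative (\<Sum>k=1..K. pep_recursion.\<psi>_dot \<kappa> \<alpha> Xs ys e \<theta> k)) (at 0) \<and>
      ((\<lambda>t. pep_recursion.\<psi>_total \<kappa> \<alpha> Xs ys K (\<theta> + t *\<^sub>R e))
         has_real_derivative (\<Sum>k=1..K. pep_recursion.\<psi>_dot \<kappa> \<alpha> Xs ys e \<theta> k)) (at 0)"
proof
  fix e :: "('p, 'd, 'm) params"
  have regular: "pep_regular \<kappa> \<alpha> \<Theta>"
    by (rule pep_regular.intro) (use assms in blast)+
  interpret pep_regular \<kappa> \<alpha> Xs ys \<Theta> by (rule regular)
  have recursive: "((\<lambda>t. \<psi>_total K (\<theta> + t *\<^sub>R e))
      has_real_derivative (\<Sum>k=1..K. \<psi>_dot e \<theta> k)) (at 0)"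
    by (rule \<psi>_total_has_derivative[OF \<open>\<theta> \<in> \<Theta>\<close>])
  \<comment> \<open>By openness the equality of the bounds on \<open>\<Theta>\<close> holds along
    the line near 0, so the derivative of the recursive bound passes to the batch bound.\<close>
  have "\<forall>\<^sub>F t in nhds 0. \<psi>_total K (\<theta> + t *\<^sub>R e) = L_PEP X y (\<theta> + t *\<^sub>R e)"
    using eventually_in_\<Theta>[OF \<open>\<theta> \<in> \<Theta>\<close>]
    by eventually_elim (rule L_PEP_eq_recursive_bound[OF regular _ assms(2-4), symmetric])
  with recursive have "((\<lambda>t. L_PEP X y (\<theta> + t *\<^sub>R e))
      has_real_derivative (\<Sum>k=1..K. \<psi>_dot e \<theta> k)) (at 0)"
    unfolding has_real_derivative_iff_has_vector_derivative
    by (rule has_vector_derivative_transform_at_eventually)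
  with recursive show "((\<lambda>t. L_PEP X y (\<theta> + t *\<^sub>R e))
         has_real_derivative (\<Sum>k=1..K. \<psi>_dot e \<theta> k)) (at 0) \<and>
      ((\<lambda>t. \<psi>_total K (\<theta> + t *\<^sub>R e)) has_real_derivative (\<Sum>k=1..K. \<psi>_dot e \<theta> k)) (at 0)"
    by blast
qed

end
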